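(* Let $r\ge2$ and let $F_1,\ldots,F_r$ be $k$-uniform hypergraphs such that $m_k(F_1)\ge m_k(F_2)\ge\cdots\ge m_k(F_r)>0$. Then there exists a constant $C>0$ such that for $p\ge Cn^{-1/m_k(F_1,F_2)}\log n$, $$\lim_{n\to\infty}\Pr[H^k(n,p)\rightarrow(F_1,\ldots,F_r)]=1.$$
   Context: $H^k(n,p)$: random $k$-uniform hypergraph on $n$ vertices, each $k$-set an edge independently with probability $p$. $G\rightarrow(F_1,\ldots,F_r)$: every colouring of $E(G)$ with colours $1,\ldots,r$ has, for some $i$, a copy of $F_i$ all of whose edges have colour $i$. $d_k(G)=0$ if $e(G)=0$, $=1/k$ if $e(G)=1,v(G)=k$, else $\frac{e(G)-1}{v(G)-k}$; $m_k(G)=\max_{H\subseteq G}d_k(H)$. $m_k(F_1,F_2)=\max\{\frac{e(F_1')}{v(F_1')-k+1/m_k(F_2)}:F_1'\subseteq F_1,e(F_1')\ge1\}$. *)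

theory Defs
  imports "HOL-Probability.Probability"
begin

datatype 'a hypergraph = Hypergraph (verts: "'a set") (edges: "'a set set")

definition uniform_hypergraph :: "nat \<Rightarrow> 'a hypergraph \<Rightarrow> bool" where
  "uniform_hypergraph k G \<longleftrightarrow>
     finite (verts G) \<and> (\<forall>e\<in>edges G. e \<subseteq> verts G \<and> card e = k)"

text \<open>Subhypergraphs need not be induced, and may contain isolated vertices.\<close>

definition subhypergraph :: "'a hypergraph \<Rightarrow> 'a hypergraph \<Rightarrow> bool" where
  "subhypergraph H G \<longleftrightarrow>
     verts H \<subseteq> verts G \<and> edges H \<subseteq> edges G \<and> (\<forall>e\<in>edges H. e \<subseteq> verts H)"

definition isomorphic :: "'a hypergraph \<Rightarrow> 'b hypergraph \<Rightarrow> bool" where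
  "isomorphic F H \<longleftrightarrow>
     (\<exists>\<phi>. bij_betw \<phi> (verts F) (verts H) \<and> edges H = (\<lambda>e. \<phi> ` e) ` edges F)"

definition k_density :: "nat \<Rightarrow> 'a hypergraph \<Rightarrow> real" where
  "k_density k G =
     (if card (edges G) = 0 then 0
      else if card (edges G) = 1 \<and> card (verts G) = k then 1 / real k
      else (real (card (edges G)) - 1) / (real (card (verts G)) - real k))"

definition max_k_density :: "nat \<Rightarrow> 'a hypergraph \<Rightarrow> real" where
  "max_k_density k G = Max {k_density k H | H. subhypergraph H G}"

definition asym_k_density :: "nat \<Rightarrow> 'a hypergraph \<Rightarrow> 'b hypergraph \<Rightarrow> real" where
  "asym_k_density k F1 F2 =
     Max {real (card (edges H)) / (real (card (verts H)) - real k + 1 / max_k_density k F2) | H.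
            subhypergraph H F1 \<and> card (edges H) \<ge> 1}"

definition arrows :: "'v hypergraph \<Rightarrow> nat \<Rightarrow> (nat \<Rightarrow> 'a hypergraph) \<Rightarrow> bool" where
  "arrows G r F \<longleftrightarrow>
     (\<forall>c :: 'v set \<Rightarrow> nat. (\<forall>e\<in>edges G. c e \<in> {1..r}) \<longrightarrow>
        (\<exists>i\<in>{1..r}. \<exists>H. subhypergraph H G \<and> isomorphic (F i) H \<and> (\<forall>e\<in>edges H. c e = i)))"

definition k_sets :: "nat \<Rightarrow> nat \<Rightarrow> nat set set" where
  "k_sets k n = {e. e \<subseteq> {1..n} \<and> card e = k}"

text \<open>The binomial random hypergraph \<open>H\<^sup>k(n,p)\<close>: one independent Bernoulli variable per
  \<open>k\<close>-subset of \<open>{1..n}\<close>, deciding whether that subset is an edge.\<close>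

definition binomial_hypergraph :: "nat \<Rightarrow> nat \<Rightarrow> real \<Rightarrow> nat hypergraph pmf" where
  "binomial_hypergraph k n p =
     map_pmf (\<lambda>X. Hypergraph {1..n} {e \<in> k_sets k n. X e})
       (Pi_pmf (k_sets k n) False (\<lambda>_. bernoulli_pmf p))"

end

theory Submission imports Defs "HOL-Library.Ramsey" begin

text \<open>In a bad colouring, each colour class \<open>i \<ge> 2\<close> is \<open>F i\<close>-free, hence lies in one of
  \<open>exp (O(n\<^bsup>k - 1/m\<^esup> log n))\<close> containers with few copies of \<open>F i\<close>, where \<open>m\<close> is the density of
  \<open>F 2\<close>. By Ramsey's theorem and averaging, the \<open>k\<close>-sets outside the chosen containers span a
  positive proportion of all copies of \<open>F 1\<close>, and the random hypergraph must avoid all of them.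
  Janson's inequality bounds the probability of this by \<open>exp (- c C n\<^bsup>k - 1/m\<^esup> log n)\<close>, because the
  asymmetric density is exactly what makes every subgraph of \<open>F 1\<close> have at least
  \<open>C n\<^bsup>k - 1/m\<^esup> log n\<close> expected copies. A union bound over the containers finishes the proof; the
  logarithm in \<open>p\<close> pays for counting them without regard to \<open>p\<close>.\<close>

section \<open>Containers for tuple systems\<close>

text \<open>Why both densities lead to one exponent: containers for \<open>F i\<close> need the
  number of copies through a set of \<open>j\<close> common edges to drop by a factor
  \<open>n powr (- 1 / m)\<close> for every edge after the first, which is what
  \<open>max_k_density\<close> guarantees. A container is then determined by
  \<open>O(n powr (k - 1 / m))\<close> chosen \<open>k\<close>-sets. As \<open>m\<close> decreases
  along the colours, colour 2 is the costliest of those that get containers.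

  Colour 1 gets none, since \<open>F 1\<close> may be denser still and its containers too many to
  pay for. It is handled through what the other containers leave over. For this the order of the
  constants matters: the supersaturation constant comes first, and containers are then built with
  fewer copies than it asks for, so that the pigeonhole can only point to colour 1. The Janson
  constant comes next, and \<open>C\<close> last.

  Injective maps are counted instead of copies. This changes counts by constant factors only, and an
  embedding keeps the labels of the edges of \<open>F\<close>, which supplies the ordered
  coordinates that the container algorithm consumes.\<close>

text \<open>A hypergraph is a set \<open>E\<close> of labels together with coordinates \<open>x a j\<close>. Since the coordinates
  are consumed in a fixed order, the link hypergraphs of the container algorithm are subsets of
  \<open>E\<close>, and multiplicities need no separate treatment.\<close>

definition codeg :: "'e set \<Rightarrow> ('e \<Rightarrow> nat \<Rightarrow> 'v) \<Rightarrow> nat set \<Rightarrow> 'e \<Rightarrow> nat" where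
  "codeg E x J a = card {b\<in>E. \<forall>j\<in>J. x b j = x a j}"

text \<open>The codegree condition of the container method: \<open>D\<close> is the scale of the
  maximum degree (singleton \<open>J\<close>), and each further prescribed coordinate must gain a
  factor \<open>p\<close>.\<close>

definition bounded_codeg ::
  "'e set \<Rightarrow> ('e \<Rightarrow> nat \<Rightarrow> 'v) \<Rightarrow> nat set \<Rightarrow> real \<Rightarrow> real \<Rightarrow> bool" where
  "bounded_codeg E x L D p \<longleftrightarrow>
     (\<forall>a\<in>E. \<forall>J. J \<subseteq> L \<and> J \<noteq> {} \<longrightarrow> real (codeg E x J a) \<le> D * p ^ (card J - 1))"

definition tuple_free :: "'e set \<Rightarrow> ('e \<Rightarrow> nat \<Rightarrow> 'v) \<Rightarrow> nat set \<Rightarrow> 'v set \<Rightarrow> bool" where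
  "tuple_free E x L I \<longleftrightarrow> \<not> (\<exists>a\<in>E. \<forall>j\<in>L. x a j \<in> I)"

lemma codeg_cong: "(\<And>j. j \<in> J \<Longrightarrow> x a j = x b j) \<Longrightarrow> codeg E x J a = codeg E x J b"
  by (auto simp: codeg_def intro!: arg_cong[where f = card])

text \<open>Double counting of the pairs in \<open>E\<close> and \<open>B\<close> that agree on
  \<open>J\<close>: each saturated edge of \<open>E\<close> accounts for
  \<open>c * D * p ^ card J\<close> of them, while each edge of \<open>B\<close> accounts for at
  most \<open>D * p ^ (card J - 1)\<close>.\<close>

lemma card_saturated_le:
  assumes "finite E" "B \<subseteq> E" and bd: "bounded_codeg E x L D p" and J: "J \<subseteq> L" "J \<noteq> {}" "finite J"
    and pos: "0 < c" "0 < D" "0 < p"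
  shows "real (card {a\<in>E. c * D * p ^ card J \<le> real (codeg B x J a)}) * (c * p) \<le> real (card B)"
proof -
  let ?S = "{a\<in>E. c * D * p ^ card J \<le> real (codeg B x J a)}"
  have finB: "finite B" using assms finite_subset by blast
  have "real (card ?S) * (c * D * p ^ card J) = (\<Sum>a\<in>?S. c * D * p ^ card J)" by simp
  also have "\<dots> \<le> (\<Sum>a\<in>?S. real (codeg B x J a))" by (rule sum_mono) auto
  also have "\<dots> \<le> (\<Sum>a\<in>E. real (codeg B x J a))" by (rule sum_mono2) (use assms in auto)
  also have "\<dots> = (\<Sum>a\<in>E. \<Sum>b\<in>B. if \<forall>j\<in>J. x b j = x a j then 1 else 0)"
    using finB by (simp add: codeg_def sum.If_cases Int_def)
  also have "\<dots> = (\<Sum>b\<in>B. \<Sum>a\<in>E. if \<forall>j\<in>J. x b j = x a j then 1 else 0)"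
    by (rule sum.swap)
  also have "\<dots> = (\<Sum>b\<in>B. real (codeg E x J b))"
    using assms(1) by (simp add: codeg_def sum.If_cases Int_def eq_commute)
  also have "\<dots> \<le> (\<Sum>b\<in>B. D * p ^ (card J - 1))"
    by (rule sum_mono) (use assms(2) bd J in \<open>auto simp: bounded_codeg_def\<close>)
  also have "\<dots> = real (card B) * (D * p ^ (card J - 1))" by simp
  finally have "real (card ?S) * (c * D * p ^ card J) \<le> real (card B) * (D * p ^ (card J - 1))" .
  moreover have "p ^ card J = p * p ^ (card J - 1)"
    using J by (cases "card J") auto
  ultimately have "(real (card ?S) * (c * p)) * (D * p ^ (card J - 1))
      \<le> real (card B) * (D * p ^ (card J - 1))"
    by (simp add: algebra_simps)
  then show ?thesis using pos by (simp add: mult_le_cancel_right)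
qed

definition covers :: "'v set set \<Rightarrow> ('v set \<Rightarrow> bool) \<Rightarrow> bool" where
  "covers \<C> P \<longleftrightarrow> (\<forall>I. P I \<longrightarrow> (\<exists>C\<in>\<C>. I \<subseteq> C))"

text \<open>\<open>B\<close> is to keep codegrees at most \<open>(c + 1) * D * p ^ card J\<close>.
  The threshold used here, with \<open>d = c * D\<close>, is one unit \<open>D * p ^ card J\<close>
  lower, and one unit is the most that a single move can add.\<close>

definition available ::
  "'e set \<Rightarrow> ('e \<Rightarrow> nat \<Rightarrow> 'v) \<Rightarrow> nat set \<Rightarrow> real \<Rightarrow> real \<Rightarrow> 'e set \<Rightarrow> 'e set" where
  "available E x L d p B =
     {a \<in> E - B. \<forall>J. J \<subseteq> L \<and> J \<noteq> {} \<longrightarrow> real (codeg B x J a) < d * p ^ card J}"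

lemma card_available_ge:
  assumes "finite E" "B \<subseteq> E" and bd: "bounded_codeg E x L D p" and L: "L' \<subseteq> L" "finite L'"
    and pos: "0 < c" "0 < D" "0 < p"
  shows "real (card E) \<le> real (card (available E x L' (c * D) p B)) + real (card B)
           + 2 ^ card L' * (real (card B) / (c * p))"
proof -
  define S where "S J = {a\<in>E. c * D * p ^ card J \<le> real (codeg B x J a)}" for J
  let ?Js = "{J. J \<subseteq> L' \<and> J \<noteq> {}}"
  have finJs: "finite ?Js" using L(2) by simp
  have finB: "finite B" using assms finite_subset by blast
  have fS: "finite (S J)" for J unfolding S_def using assms(1) by simp
  have cS: "real (card (S J)) \<le> real (card B) / (c * p)" if "J \<in> ?Js" for J
  proof -
    have "finite J" using that L finite_subset by blast
    then have "real (card (S J)) * (c * p) \<le> real (card B)"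
      unfolding S_def using that L by (intro card_saturated_le[OF assms(1,2) bd _ _ _ pos]) auto
    then show ?thesis using pos by (simp add: pos_le_divide_eq)
  qed
  have sub: "E \<subseteq> available E x L' (c * D) p B \<union> B \<union> (\<Union>J\<in>?Js. S J)"
  proof
    fix a assume "a \<in> E"
    show "a \<in> available E x L' (c * D) p B \<union> B \<union> (\<Union>J\<in>?Js. S J)"
    proof (cases "\<exists>J\<in>?Js. a \<in> S J")
      case False
      then have "real (codeg B x J a) < c * D * p ^ card J" if "J \<in> ?Js" for J
        using that \<open>a \<in> E\<close> unfolding S_def by (metis (no_types, lifting) mem_Collect_eq not_less)
      then show ?thesis using \<open>a \<in> E\<close> unfolding available_def by simp
    qed blast
  qed
  have fA: "finite (available E x L' (c * D) p B)" using assms(1) by (auto simp: available_def)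
  have "card E \<le> card (available E x L' (c * D) p B \<union> B \<union> (\<Union>J\<in>?Js. S J))"
    by (rule card_mono[OF _ sub]) (use fA finB finJs fS in auto)
  also have "\<dots> \<le> card (available E x L' (c * D) p B) + card B + card (\<Union>J\<in>?Js. S J)"
    by (meson card_Un_le add_mono_thms_linordered_semiring(1) order_refl order_trans)
  also have "\<dots> \<le> card (available E x L' (c * D) p B) + card B + (\<Sum>J\<in>?Js. card (S J))"
    using card_UN_le[OF finJs, of S] by simp
  finally have "real (card E) \<le> real (card (available E x L' (c * D) p B)) + real (card B)
     + (\<Sum>J\<in>?Js. real (card (S J)))" by (simp flip: of_nat_add of_nat_sum)
  also have "(\<Sum>J\<in>?Js. real (card (S J))) \<le> (\<Sum>J\<in>?Js. real (card B) / (c * p))"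
    by (rule sum_mono) (use cS in auto)
  also have "\<dots> = real (card ?Js) * (real (card B) / (c * p))" by simp
  also have "\<dots> \<le> 2 ^ card L' * (real (card B) / (c * p))"
  proof (rule mult_right_mono)
    have "card ?Js \<le> card (Pow L')" by (rule card_mono) (use L in auto)
    then show "real (card ?Js) \<le> 2 ^ card L'" using L(2) by (simp add: card_Pow)
    show "0 \<le> real (card B) / (c * p)" using pos by simp
  qed
  finally show ?thesis by simp
qed

text \<open>If no picked edge agrees with \<open>a\<close> on \<open>J\<close>, the old bound for
  \<open>B\<close> remains. Otherwise some available \<open>b\<close> does, so the codegree in
  \<open>B\<close> was below the threshold. All picked edges also share the coordinate
  \<open>i\<close>, so the codegree of \<open>insert i J\<close> in \<open>E\<close> bounds the
  increase by \<open>D * p ^ card J\<close>.\<close>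

lemma bounded_codeg_pick:
  assumes "finite E" "B \<subseteq> E" and bd: "bounded_codeg E x L D p"
    and bdB: "bounded_codeg B x L' ((c + 1) * p * D) p" and L: "L' \<subseteq> L" "i \<in> L" "i \<notin> L'" "finite L'"
  shows "bounded_codeg (B \<union> {a \<in> available E x L' (c * D) p B. x a i = v}) x L' ((c + 1) * p * D) p"
  unfolding bounded_codeg_def
proof (intro ballI allI impI)
  define A where "A = {a \<in> available E x L' (c * D) p B. x a i = v}"
  fix a J assume a: "a \<in> B \<union> {a \<in> available E x L' (c * D) p B. x a i = v}" and J: "J \<subseteq> L' \<and> J \<noteq> {}"
  have finB: "finite B" and finA: "finite A"
    using assms finite_subset by (auto simp: A_def available_def)
  have finJ: "finite J" using J L finite_subset by blast
  have le: "codeg (B \<union> A) x J a \<le> codeg B x J a + codeg A x J a"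
  proof -
    have "{b \<in> B \<union> A. \<forall>j\<in>J. x b j = x a j}
        = {b \<in> B. \<forall>j\<in>J. x b j = x a j} \<union> {b \<in> A. \<forall>j\<in>J. x b j = x a j}" by auto
    then show ?thesis unfolding codeg_def by (simp add: card_Un_le)
  qed
  show "real (codeg (B \<union> {a \<in> available E x L' (c * D) p B. x a i = v}) x J a)
      \<le> (c + 1) * p * D * p ^ (card J - 1)"
  proof (cases "\<exists>b\<in>A. \<forall>j\<in>J. x b j = x a j")
    case False
    then have "{b \<in> A. \<forall>j\<in>J. x b j = x a j} = {}" by blast
    then have "codeg A x J a = 0" unfolding codeg_def by (metis card.empty)
    moreover have "a \<in> B" using a False by (auto simp: A_def)
    ultimately show ?thesis using le bdB J unfolding bounded_codeg_def A_def[symmetric]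
      by (metis add.right_neutral of_nat_le_iff order_trans)
  next
    case True
    then obtain b where b: "b \<in> A" "\<forall>j\<in>J. x b j = x a j" by auto
    have eq: "p ^ card J = p * p ^ (card J - 1)"
      using J finJ by (cases "card J") auto
    have "codeg B x J a = codeg B x J b" using b by (intro codeg_cong) auto
    moreover have "real (codeg B x J b) \<le> c * D * p ^ card J"
      using b J by (auto simp: A_def available_def intro: less_imp_le)
    moreover have "codeg A x J a \<le> codeg E x (insert i J) b"
      unfolding codeg_def by (rule card_mono) (use assms(1) b in \<open>auto simp: A_def available_def\<close>)
    moreover have "real (codeg E x (insert i J) b) \<le> D * p ^ (card (insert i J) - 1)"
    proof -
      have "b \<in> E" using b by (auto simp: A_def available_def)
      moreover have "insert i J \<subseteq> L" "insert i J \<noteq> {}" using J L by auto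
      ultimately show ?thesis using bd unfolding bounded_codeg_def by blast
    qed
    moreover have "card (insert i J) - 1 = card J" using finJ J L by (subst card_insert_disjoint) auto
    ultimately have "real (codeg (B \<union> A) x J a) \<le> c * D * p ^ card J + D * p ^ card J"
      using le by (smt (verit) of_nat_add of_nat_le_iff)
    also have "\<dots> = (c + 1) * p * D * p ^ (card J - 1)" unfolding eq by (simp add: algebra_simps)
    finally show ?thesis unfolding A_def .
  qed
qed

text \<open>Vertices of degree at least \<open>d\<close> contribute at most \<open>D\<close> edges
  each, and all others less than \<open>d\<close>. Together with a lower bound on
  \<open>card A\<close> this forces many vertices of high degree.\<close>

lemma card_high_degree_ge:
  assumes "finite V" "finite A" "\<And>a. a \<in> A \<Longrightarrow> y a \<in> V" "real (card V) \<le> N"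
    and "\<And>v. v \<in> V \<Longrightarrow> real (card {a\<in>A. y a = v}) \<le> D" "0 \<le> d"
  shows "real (card A) \<le> real (card {v\<in>V. d \<le> real (card {a\<in>A. y a = v})}) * D + N * d"
proof -
  let ?H = "{v\<in>V. d \<le> real (card {a\<in>A. y a = v})}"
  have "card A = (\<Sum>v\<in>V. card {a\<in>A. y a = v})"
    by (rule sum.group[of A V y "\<lambda>_. 1::nat", simplified, symmetric]) (use assms in auto)
  then have "real (card A) = (\<Sum>v\<in>V. real (card {a\<in>A. y a = v}))" by simp
  also have "\<dots> \<le> (\<Sum>v\<in>V. (if v \<in> ?H then D else 0) + d)"
    by (rule sum_mono) (use assms(5,6) in \<open>fastforce simp: not_le\<close>)
  also have "\<dots> = real (card ?H) * D + real (card V) * d"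
    using assms(1) by (simp add: sum.distrib sum.If_cases Int_def)
  also have "\<dots> \<le> real (card ?H) * D + N * d"
    using assms(4,6) by (simp add: mult_right_mono)
  finally show ?thesis .
qed

text \<open>One stage of the algorithm on coordinate \<open>i\<close>. As long as the independent set \<open>I\<close> contains a
  vertex \<open>v\<close> of high degree among the available edges, move all available edges with \<open>i\<close>-th
  coordinate \<open>v\<close> into \<open>B\<close>; edges through a saturated codegree of \<open>B\<close> are no longer available. If
  this stops early, \<open>I\<close> avoids the many vertices of high degree; otherwise \<open>B\<close> is a large
  hypergraph on the remaining coordinates for which \<open>I\<close> is independent.\<close>

lemma container_stage:
  fixes E :: "'e set" and x :: "'e \<Rightarrow> nat \<Rightarrow> 'v" and V :: "'v set"
  assumes "finite E" "finite V" "card V \<le> N" and xV: "\<And>a. a \<in> E \<Longrightarrow> x a i \<in> V"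
    and bd: "bounded_codeg E x L D p" and L: "L = insert i L'" "i \<notin> L'" "finite L'"
    and pos: "0 < \<epsilon>" "0 < D" "0 < p" and p: "p \<le> \<epsilon> / 4" and q: "real q \<le> p * real N"
    and E: "\<epsilon> * D * real N \<le> real (card E)"
    and c: "c = 2 ^ (card L' + 2) / \<epsilon>" and \<gamma>: "\<gamma> \<le> \<epsilon> / 4" and M: "1 \<le> M"
    and last: "\<And>B. B \<subseteq> E \<Longrightarrow> bounded_codeg B x L' ((c + 1) * p * D) p
      \<Longrightarrow> real q * (\<epsilon> / 4 * D) \<le> real (card B) \<Longrightarrow>
      \<exists>\<C>. finite \<C> \<and> card \<C> \<le> M \<and> (\<forall>C\<in>\<C>. C \<subseteq> V \<and> \<gamma> * real N \<le> real (card (V - C)))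
        \<and> covers \<C> (\<lambda>I. I \<subseteq> V \<and> tuple_free B x L' I)"
  shows "\<exists>\<C>. finite \<C> \<and> card \<C> \<le> (N + 1) ^ q * M
      \<and> (\<forall>C\<in>\<C>. C \<subseteq> V \<and> \<gamma> * real N \<le> real (card (V - C)))
      \<and> covers \<C> (\<lambda>I. I \<subseteq> V \<and> tuple_free E x L I)"
proof -
  let ?good = "\<lambda>C. C \<subseteq> V \<and> \<gamma> * real N \<le> real (card (V - C))"
  have c0: "0 < c" using pos c by simp
  have deg_i: "real (card {a\<in>E. x a i = v}) \<le> D" for v
  proof (cases "\<exists>a\<in>E. x a i = v")
    case True
    then obtain a where a: "a \<in> E" "x a i = v" by blast
    then have "real (codeg E x {i} a) \<le> D * p ^ (card {i} - 1)"
      using bd L unfolding bounded_codeg_def by blast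
    then show ?thesis using a by (simp add: codeg_def)
  next
    case False
    then have "{a\<in>E. x a i = v} = {}" by blast
    then show ?thesis using pos by (simp only: card.empty)
  qed
  \<comment> \<open>Here \<open>m\<close> is the number of moves still to be made. The lower bound
    on \<open>card B\<close> makes the final \<open>B\<close> large enough for \<open>last\<close>;
    the upper bound keeps it so small that most edges stay available. That \<open>I\<close> contains
    all coordinates \<open>x a i\<close> of \<open>B\<close> is what makes \<open>I\<close>
    tuple-free for \<open>B\<close> without the coordinate \<open>i\<close>.\<close>
  have key: "\<exists>\<C>. finite \<C> \<and> card \<C> \<le> (N + 1) ^ m * M \<and> (\<forall>C\<in>\<C>. ?good C)
      \<and> covers \<C> (\<lambda>I. I \<subseteq> V \<and> tuple_free E x L I \<and> (\<forall>a\<in>B. x a i \<in> I))"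
    if "m \<le> q" "B \<subseteq> E" "bounded_codeg B x L' ((c + 1) * p * D) p"
      "(real q - real m) * (\<epsilon> / 4 * D) \<le> real (card B)" "real (card B) \<le> (real q - real m) * D"
    for m B
    using that
  proof (induction m arbitrary: B)
    case 0
    then obtain \<C> where \<C>: "finite \<C>" "card \<C> \<le> M" "\<forall>C\<in>\<C>. ?good C"
      "covers \<C> (\<lambda>I. I \<subseteq> V \<and> tuple_free B x L' I)"
      using last[of B] by auto
    have "tuple_free B x L' I" if "tuple_free E x L I" "\<forall>a\<in>B. x a i \<in> I" for I
      using that 0(2) L(1) unfolding tuple_free_def by blast
    then have "covers \<C> (\<lambda>I. I \<subseteq> V \<and> tuple_free E x L I \<and> (\<forall>a\<in>B. x a i \<in> I))"
      using \<C>(4) unfolding covers_def by blast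
    with \<C> show ?case by (intro exI[of _ \<C>]) simp
  next
    case (Suc m)
    define A where "A = available E x L' (c * D) p B"
    define pick where "pick v = {a\<in>A. x a i = v}" for v
    define H where "H = {v\<in>V. \<epsilon> / 4 * D \<le> real (card (pick v))}"
    have AE: "A \<subseteq> E - B" unfolding A_def available_def by blast
    have finA: "finite A" and finB: "finite B" using AE Suc.prems(2) assms(1) finite_subset by blast+
    have finH: "finite H" using assms(2) unfolding H_def by simp
    have pick_le: "real (card (pick v)) \<le> D" for v
    proof -
      have "card (pick v) \<le> card {a\<in>E. x a i = v}"
        by (rule card_mono) (use assms(1) AE in \<open>auto simp: pick_def\<close>)
      then show ?thesis using deg_i[of v] by linarith
    qed
    have cardB: "real (card B) \<le> p * real N * D"
    proof -
      have "real (card B) \<le> (real q - real (Suc m)) * D" by (rule Suc.prems(5))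
      also have "\<dots> \<le> real q * D" using pos by (intro mult_right_mono) auto
      also have "\<dots> \<le> p * real N * D" using q pos by (intro mult_right_mono) auto
      finally show ?thesis .
    qed
    \<comment> \<open>Of \<open>\<epsilon> * D * N\<close> edges, at most a quarter is lost to
      \<open>B\<close>, by \<open>p \<le> \<epsilon> / 4\<close>, and at most a quarter to
      saturation, by the choice of \<open>c\<close>.\<close>
    have cardA: "\<epsilon> / 2 * D * real N \<le> real (card A)"
    proof -
      have "real (card E) \<le> real (card A) + real (card B) + 2 ^ card L' * (real (card B) / (c * p))"
        unfolding A_def by (rule card_available_ge[OF assms(1) Suc.prems(2) bd]) (use L c0 pos in auto)
      moreover have "real (card B) \<le> \<epsilon> / 4 * D * real N"
      proof -
        have "p * (real N * D) \<le> \<epsilon> / 4 * (real N * D)"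
          by (rule mult_right_mono) (use p pos in auto)
        then show ?thesis using cardB by (simp add: algebra_simps)
      qed
      moreover have "2 ^ card L' * (real (card B) / (c * p)) \<le> \<epsilon> / 4 * D * real N"
      proof -
        have "real (card B) / (c * p) \<le> p * real N * D / (c * p)"
          using cardB c0 pos by (intro divide_right_mono) auto
        also have "\<dots> = real N * D / c" using pos by simp
        finally have "2 ^ card L' * (real (card B) / (c * p)) \<le> 2 ^ card L' * (real N * D / c)"
          by (intro mult_left_mono) auto
        also have "\<dots> = \<epsilon> / 4 * D * real N" unfolding c using pos by (simp add: power_add field_simps)
        finally show ?thesis .
      qed
      ultimately have "\<epsilon> * D * real N \<le> real (card A) + \<epsilon> / 4 * D * real N + \<epsilon> / 4 * D * real N"
        using E by linarith
      then show ?thesis by (simp add: algebra_simps)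
    qed
    \<comment> \<open>Vertices of low degree carry at most \<open>\<epsilon> / 4 * D * N\<close> of
      the available edges, half of what is known to be there.\<close>
    have high: "\<epsilon> / 4 * real N \<le> real (card H)"
    proof -
      have "real (card A) \<le> real (card H) * D + real N * (\<epsilon> / 4 * D)"
        unfolding H_def pick_def
        by (rule card_high_degree_ge[of V A "\<lambda>a. x a i"])
           (use assms(2,3) finA AE xV pick_le pos in \<open>auto simp: pick_def\<close>)
      then have "\<epsilon> / 4 * real N * D \<le> real (card H) * D" using cardA by (simp add: algebra_simps)
      then show ?thesis using pos by (simp add: mult_le_cancel_right)
    qed
    have step: "\<exists>\<C>. finite \<C> \<and> card \<C> \<le> (N + 1) ^ m * M \<and> (\<forall>C\<in>\<C>. ?good C)
      \<and> covers \<C> (\<lambda>I. I \<subseteq> V \<and> tuple_free E x L I \<and> (\<forall>a\<in>B \<union> pick v. x a i \<in> I))" if "v \<in> H" for v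
    proof (rule Suc.IH)
      have card_eq: "real (card (B \<union> pick v)) = real (card B) + real (card (pick v))"
      proof -
        have "B \<inter> pick v = {}" "finite (pick v)" using AE finA unfolding pick_def by auto
        then show ?thesis using finB by (simp add: card_Un_disjoint)
      qed
      show "m \<le> q" using Suc.prems by simp
      show "B \<union> pick v \<subseteq> E" using Suc.prems(2) AE unfolding pick_def by blast
      show "bounded_codeg (B \<union> pick v) x L' ((c + 1) * p * D) p"
        unfolding pick_def A_def
        by (rule bounded_codeg_pick[OF assms(1) Suc.prems(2) bd Suc.prems(3)]) (use L in auto)
      show "(real q - real m) * (\<epsilon> / 4 * D) \<le> real (card (B \<union> pick v))"
        using Suc.prems(4) that unfolding card_eq H_def by (simp add: algebra_simps)
      show "real (card (B \<union> pick v)) \<le> (real q - real m) * D"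
        using Suc.prems(5) pick_le[of v] unfolding card_eq by (simp add: algebra_simps)
    qed
    have "\<exists>\<C>. \<forall>v\<in>H. finite (\<C> v) \<and> card (\<C> v) \<le> (N + 1) ^ m * M \<and> (\<forall>C\<in>\<C> v. ?good C)
        \<and> covers (\<C> v) (\<lambda>I. I \<subseteq> V \<and> tuple_free E x L I \<and> (\<forall>a\<in>B \<union> pick v. x a i \<in> I))"
      by (rule bchoice, rule ballI, rule step)
    then obtain \<C> where \<C>: "\<And>v. v \<in> H \<Longrightarrow> finite (\<C> v) \<and> card (\<C> v) \<le> (N + 1) ^ m * M
        \<and> (\<forall>C\<in>\<C> v. ?good C)
        \<and> covers (\<C> v) (\<lambda>I. I \<subseteq> V \<and> tuple_free E x L I \<and> (\<forall>a\<in>B \<union> pick v. x a i \<in> I))"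
      by blast
    show ?case
    proof (intro exI conjI)
      let ?\<D> = "insert (V - H) (\<Union>v\<in>H. \<C> v)"
      show "finite ?\<D>" using \<C> finH by auto
      have "card ?\<D> \<le> 1 + card (\<Union>v\<in>H. \<C> v)"
        using \<C> finH by (simp add: card_insert_if)
      also have "card (\<Union>v\<in>H. \<C> v) \<le> (\<Sum>v\<in>H. card (\<C> v))" by (rule card_UN_le[OF finH])
      also have "\<dots> \<le> (\<Sum>v\<in>H. (N + 1) ^ m * M)" by (rule sum_mono) (use \<C> in auto)
      also have "\<dots> = card H * ((N + 1) ^ m * M)" by simp
      also have "\<dots> \<le> N * ((N + 1) ^ m * M)"
      proof (rule mult_right_mono)
        have "card H \<le> card V" unfolding H_def by (rule card_mono) (use assms(2) in auto)
        then show "card H \<le> N" using assms(3) by simp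
      qed simp
      \<comment> \<open>The additional 1 is the container \<open>V - H\<close>, for sets that miss
        \<open>H\<close> entirely. It is absorbed because \<open>M\<close> is at least 1.\<close>
      also have "1 + N * ((N + 1) ^ m * M) \<le> (N + 1) ^ Suc m * M"
        using M by (simp add: algebra_simps)
      finally show "card ?\<D> \<le> (N + 1) ^ Suc m * M" by simp
      show "\<forall>C\<in>?\<D>. ?good C"
      proof
        fix C assume "C \<in> ?\<D>"
        then consider "C = V - H" | v where "v \<in> H" "C \<in> \<C> v" by blast
        then show "?good C"
        proof cases
          case 1
          have "V - (V - H) = H" unfolding H_def by blast
          moreover have "\<gamma> * real N \<le> \<epsilon> / 4 * real N" using \<gamma> by (intro mult_right_mono) auto
          ultimately show ?thesis using 1 high by auto
        next
          case 2
          then show ?thesis using \<C> by blast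
        qed
      qed
      show "covers ?\<D> (\<lambda>I. I \<subseteq> V \<and> tuple_free E x L I \<and> (\<forall>a\<in>B. x a i \<in> I))"
        unfolding covers_def
      proof (intro allI impI)
        fix I assume I: "I \<subseteq> V \<and> tuple_free E x L I \<and> (\<forall>a\<in>B. x a i \<in> I)"
        show "\<exists>C\<in>?\<D>. I \<subseteq> C"
        proof (cases "I \<inter> H = {}")
          case True
          then have "I \<subseteq> V - H" using I by blast
          then show ?thesis by (intro bexI[of _ "V - H"]) auto
        next
          case False
          then obtain v where v: "v \<in> I" "v \<in> H" by blast
          then have "\<forall>a\<in>B \<union> pick v. x a i \<in> I" using I unfolding pick_def by blast
          moreover have "covers (\<C> v) (\<lambda>I. I \<subseteq> V \<and> tuple_free E x L I \<and> (\<forall>a\<in>B \<union> pick v. x a i \<in> I))"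
            using \<C>[OF v(2)] by (elim conjE)
          ultimately obtain C where "C \<in> \<C> v" "I \<subseteq> C" using I unfolding covers_def by meson
          then show ?thesis using v(2) by (intro bexI[of _ C]) auto
        qed
      qed
    qed
  qed
  have "\<exists>\<C>. finite \<C> \<and> card \<C> \<le> (N + 1) ^ q * M \<and> (\<forall>C\<in>\<C>. ?good C)
      \<and> covers \<C> (\<lambda>I. I \<subseteq> V \<and> tuple_free E x L I \<and> (\<forall>a\<in>{}. x a i \<in> I))"
    by (rule key) (simp_all add: bounded_codeg_def)
  then obtain \<C> where \<C>: "finite \<C>" "card \<C> \<le> (N + 1) ^ q * M" "\<forall>C\<in>\<C>. ?good C"
      "covers \<C> (\<lambda>I. I \<subseteq> V \<and> tuple_free E x L I \<and> (\<forall>a\<in>{}. x a i \<in> I))"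
    by (elim exE conjE) (rule that; assumption)
  moreover have "covers \<C> (\<lambda>I. I \<subseteq> V \<and> tuple_free E x L I)"
    using \<C>(4) unfolding covers_def by simp
  ultimately show ?thesis by (intro exI[of _ \<C>] conjI)
qed

text \<open>Iterates \<open>container_stage\<close> over the last \<open>n\<close> coordinates, with
  \<open>D\<close> shrinking by the factor \<open>(c + 1) * p\<close> per stage. The constants
  \<open>\<gamma>\<close> and \<open>p0\<close> depend only on \<open>l\<close>, \<open>n\<close>
  and \<open>\<epsilon>\<close>, and each stage contributes one factor
  \<open>(N + 1) ^ q\<close>.\<close>

lemma container_step:
  fixes l n :: nat and \<epsilon> :: real
  assumes "n \<le> l" "0 < \<epsilon>"
  shows "\<exists>\<gamma>>0. \<exists>p0>0. \<forall>(E :: 'e set) (x :: 'e \<Rightarrow> nat \<Rightarrow> 'v) V N q D p.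
    finite E \<longrightarrow> finite V \<longrightarrow> card V \<le> N \<longrightarrow> (\<forall>a\<in>E. \<forall>j<l. x a j \<in> V) \<longrightarrow> 0 < N \<longrightarrow>
    0 < p \<longrightarrow> p \<le> p0 \<longrightarrow> 0 < D \<longrightarrow> real q \<le> p * real N \<longrightarrow> p * real N \<le> 2 * real q \<longrightarrow>
    bounded_codeg E x {l - n..<l} D p \<longrightarrow> \<epsilon> * D * real N \<le> real (card E) \<longrightarrow>
    (\<exists>\<C>. finite \<C> \<and> card \<C> \<le> (N + 1) ^ (n * q)
      \<and> (\<forall>C\<in>\<C>. C \<subseteq> V \<and> \<gamma> * real N \<le> real (card (V - C)))
      \<and> covers \<C> (\<lambda>I. I \<subseteq> V \<and> tuple_free E x {l - n..<l} I))"
  using assms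
proof (induction n arbitrary: \<epsilon>)
  case 0
  have *: "\<exists>\<C>. finite \<C> \<and> card \<C> \<le> (N + 1) ^ (0 * q)
      \<and> (\<forall>C\<in>\<C>. C \<subseteq> V \<and> 1 * real N \<le> real (card (V - C)))
      \<and> covers \<C> (\<lambda>I. I \<subseteq> V \<and> tuple_free E x {l - 0..<l} I)"
    if "0 < N" "0 < D" "\<epsilon> * D * real N \<le> real (card E)"
    for E :: "'e set" and x :: "'e \<Rightarrow> nat \<Rightarrow> 'v" and V N q D
  proof -
    have "0 < \<epsilon> * D * real N" using that 0 by simp
    then have "E \<noteq> {}" using that by auto
    \<comment> \<open>With no coordinates left, any edge rules out tuple-freeness vacuously. As
      \<open>E\<close> is nonempty there is nothing to cover, and the empty family will do.\<close>
    then show ?thesis by (intro exI[of _ "{}"]) (auto simp: covers_def tuple_free_def)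
  qed
  show ?case
    by (rule exI[of _ 1], rule conjI, simp, rule exI[of _ 1], rule conjI, simp, intro allI impI, rule *; assumption)
next
  case (Suc n)
  define c where "c = 2 ^ (n + 2) / \<epsilon>"
  \<comment> \<open>After \<open>q\<close> moves, with \<open>q\<close> at least
    \<open>p * N / 2\<close>, \<open>B\<close> has at least
    \<open>\<epsilon> / 8 * D * p * N\<close> edges. Measured against the new degree scale
    \<open>(c + 1) * p * D\<close> this is density \<open>\<epsilon>'\<close>.\<close>
  define \<epsilon>' where "\<epsilon>' = \<epsilon> / 4 / (2 * (c + 1))"
  have c0: "0 < c" and e0: "0 < \<epsilon>'" using Suc.prems by (auto simp: c_def \<epsilon>'_def add_pos_pos)
  define i where "i = l - Suc n"
  have L: "{l - Suc n..<l} = insert i {l - n..<l}" "i \<notin> {l - n..<l}" "card {l - n..<l} = n"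
    "i < l" "{l - n..<l} \<subseteq> {..<l}"
    using Suc.prems unfolding i_def by auto
  obtain \<gamma>' p0' where g: "0 < \<gamma>'" "0 < p0'" and IH: "\<forall>(E :: 'e set) (x :: 'e \<Rightarrow> nat \<Rightarrow> 'v) V N q D p.
    finite E \<longrightarrow> finite V \<longrightarrow> card V \<le> N \<longrightarrow> (\<forall>a\<in>E. \<forall>j<l. x a j \<in> V) \<longrightarrow> 0 < N \<longrightarrow>
    0 < p \<longrightarrow> p \<le> p0' \<longrightarrow> 0 < D \<longrightarrow> real q \<le> p * real N \<longrightarrow> p * real N \<le> 2 * real q \<longrightarrow>
    bounded_codeg E x {l - n..<l} D p \<longrightarrow> \<epsilon>' * D * real N \<le> real (card E) \<longrightarrow>
    (\<exists>\<C>. finite \<C> \<and> card \<C> \<le> (N + 1) ^ (n * q)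
      \<and> (\<forall>C\<in>\<C>. C \<subseteq> V \<and> \<gamma>' * real N \<le> real (card (V - C)))
      \<and> covers \<C> (\<lambda>I. I \<subseteq> V \<and> tuple_free E x {l - n..<l} I))"
    using Suc.IH[OF Suc_leD[OF Suc.prems(1)] e0] by (elim exE conjE) (rule that; assumption)
  define \<gamma> where "\<gamma> = min \<gamma>' (\<epsilon> / 4)"
  have main: "\<exists>\<C>. finite \<C> \<and> card \<C> \<le> (N + 1) ^ (Suc n * q)
      \<and> (\<forall>C\<in>\<C>. C \<subseteq> V \<and> \<gamma> * real N \<le> real (card (V - C)))
      \<and> covers \<C> (\<lambda>I. I \<subseteq> V \<and> tuple_free E x {l - Suc n..<l} I)"
    if hyp: "finite E" "finite V" "card V \<le> N" "\<forall>a\<in>E. \<forall>j<l. x a j \<in> V" "0 < N"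
      "0 < p" "p \<le> min p0' (\<epsilon> / 4)" "0 < D" "real q \<le> p * real N" "p * real N \<le> 2 * real q"
      "bounded_codeg E x {l - Suc n..<l} D p" "\<epsilon> * D * real N \<le> real (card E)"
    for E :: "'e set" and x :: "'e \<Rightarrow> nat \<Rightarrow> 'v" and V N q D p
  proof -
    have "\<exists>\<C>. finite \<C> \<and> card \<C> \<le> (N + 1) ^ q * (N + 1) ^ (n * q)
      \<and> (\<forall>C\<in>\<C>. C \<subseteq> V \<and> \<gamma> * real N \<le> real (card (V - C)))
      \<and> covers \<C> (\<lambda>I. I \<subseteq> V \<and> tuple_free E x {l - Suc n..<l} I)"
    proof (rule container_stage[where i = i and L' = "{l - n..<l}" and c = c and \<epsilon> = \<epsilon> and D = D and p = p])
      fix B assume B: "B \<subseteq> E" "bounded_codeg B x {l - n..<l} ((c + 1) * p * D) p"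
        "real q * (\<epsilon> / 4 * D) \<le> real (card B)"
      have "\<epsilon>' * ((c + 1) * p * D) * real N = p * real N * (\<epsilon> / 8 * D)"
        using c0 unfolding \<epsilon>'_def by (simp add: field_simps)
      also have "\<dots> \<le> 2 * real q * (\<epsilon> / 8 * D)"
        using hyp Suc.prems by (intro mult_right_mono) auto
      also have "\<dots> \<le> real (card B)" using B(3) by (simp add: mult_ac)
      finally have big: "\<epsilon>' * ((c + 1) * p * D) * real N \<le> real (card B)" .
      have "\<exists>\<C>. finite \<C> \<and> card \<C> \<le> (N + 1) ^ (n * q)
        \<and> (\<forall>C\<in>\<C>. C \<subseteq> V \<and> \<gamma>' * real N \<le> real (card (V - C)))
        \<and> covers \<C> (\<lambda>I. I \<subseteq> V \<and> tuple_free B x {l - n..<l} I)"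
      proof (rule IH[rule_format, where D = "(c + 1) * p * D" and p = p])
        show "finite B" using B(1) hyp(1) by (rule finite_subset)
        show "\<And>a j. a \<in> B \<Longrightarrow> j < l \<Longrightarrow> x a j \<in> V" using B(1) hyp(4) by blast
        show "0 < (c + 1) * p * D" using c0 hyp by simp
      qed (use hyp B big in auto)
      then obtain \<C> where \<C>: "finite \<C>" "card \<C> \<le> (N + 1) ^ (n * q)"
        "\<forall>C\<in>\<C>. C \<subseteq> V \<and> \<gamma>' * real N \<le> real (card (V - C))"
        "covers \<C> (\<lambda>I. I \<subseteq> V \<and> tuple_free B x {l - n..<l} I)"
        by (elim exE conjE) (rule that; assumption)
      have "\<gamma> * real N \<le> \<gamma>' * real N" unfolding \<gamma>_def by (intro mult_right_mono) auto
      then have "\<forall>C\<in>\<C>. C \<subseteq> V \<and> \<gamma> * real N \<le> real (card (V - C))" using \<C>(3) by fastforce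
      with \<C> show "\<exists>\<C>. finite \<C> \<and> card \<C> \<le> (N + 1) ^ (n * q)
        \<and> (\<forall>C\<in>\<C>. C \<subseteq> V \<and> \<gamma> * real N \<le> real (card (V - C)))
        \<and> covers \<C> (\<lambda>I. I \<subseteq> V \<and> tuple_free B x {l - n..<l} I)" by (intro exI[of _ \<C>] conjI)
    qed (use hyp L Suc.prems in \<open>auto simp: \<gamma>_def c_def\<close>)
    then show ?thesis by (simp only: power_add[symmetric] mult_Suc)
  qed
  have \<gamma>0: "0 < \<gamma>" and p0: "0 < min p0' (\<epsilon> / 4)" using g Suc.prems by (auto simp: \<gamma>_def)
  show ?case
    by (rule exI[of _ \<gamma>], rule conjI, rule \<gamma>0, rule exI[of _ "min p0' (\<epsilon> / 4)"], rule conjI, rule p0,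
        intro allI impI, rule main; assumption)
qed

text \<open>\<open>container_step\<close> only removes a fraction of the vertices. It is reapplied
  inside each container that still has many edges; \<open>D\<close> and \<open>N\<close> keep their
  original values, so every round removes another \<open>\<gamma> * N\<close> vertices and the
  number of rounds is bounded.\<close>

theorem containers:
  fixes l :: nat and \<epsilon> :: real
  assumes "0 < l" "0 < \<epsilon>"
  shows "\<exists>T. \<exists>p0>0. \<forall>(E :: 'e set) (x :: 'e \<Rightarrow> nat \<Rightarrow> 'v) V N q D p.
    finite E \<longrightarrow> finite V \<longrightarrow> card V \<le> N \<longrightarrow> (\<forall>a\<in>E. \<forall>j<l. x a j \<in> V) \<longrightarrow> 0 < N \<longrightarrow>
    0 < p \<longrightarrow> p \<le> p0 \<longrightarrow> 0 < D \<longrightarrow> real q \<le> p * real N \<longrightarrow> p * real N \<le> 2 * real q \<longrightarrow>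
    bounded_codeg E x {..<l} D p \<longrightarrow>
    (\<exists>\<C>. finite \<C> \<and> card \<C> \<le> (N + 1) ^ (T * q)
      \<and> (\<forall>C\<in>\<C>. C \<subseteq> V \<and> real (card {a\<in>E. \<forall>j<l. x a j \<in> C}) < \<epsilon> * D * real N)
      \<and> covers \<C> (\<lambda>I. I \<subseteq> V \<and> tuple_free E x {..<l} I))"
proof -
  obtain \<gamma> p0 where g: "0 < \<gamma>" "0 < p0" and step: "\<forall>(E :: 'e set) (x :: 'e \<Rightarrow> nat \<Rightarrow> 'v) V N q D p.
    finite E \<longrightarrow> finite V \<longrightarrow> card V \<le> N \<longrightarrow> (\<forall>a\<in>E. \<forall>j<l. x a j \<in> V) \<longrightarrow> 0 < N \<longrightarrow>
    0 < p \<longrightarrow> p \<le> p0 \<longrightarrow> 0 < D \<longrightarrow> real q \<le> p * real N \<longrightarrow> p * real N \<le> 2 * real q \<longrightarrow>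
    bounded_codeg E x {l - l..<l} D p \<longrightarrow> \<epsilon> * D * real N \<le> real (card E) \<longrightarrow>
    (\<exists>\<C>. finite \<C> \<and> card \<C> \<le> (N + 1) ^ (l * q)
      \<and> (\<forall>C\<in>\<C>. C \<subseteq> V \<and> \<gamma> * real N \<le> real (card (V - C)))
      \<and> covers \<C> (\<lambda>I. I \<subseteq> V \<and> tuple_free E x {l - l..<l} I))"
    using container_step[OF order_refl assms(2), of l, where 'e = 'e and 'v = 'v]
    by (elim exE conjE) (rule that; assumption)
  have ll: "{l - l..<l} = {..<l}" by auto
  \<comment> \<open>The number of rounds after which removing \<open>\<gamma> * N\<close> vertices
    at a time has exhausted \<open>V\<close>.\<close>
  define t where "t = nat \<lceil>1 / \<gamma>\<rceil>"
  have t: "1 \<le> real t * \<gamma>"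
  proof -
    have "1 / \<gamma> \<le> real t" unfolding t_def by linarith
    then show ?thesis using g by (simp add: field_simps)
  qed
  have main: "\<exists>\<C>. finite \<C> \<and> card \<C> \<le> (N + 1) ^ (l * t * q)
      \<and> (\<forall>C\<in>\<C>. C \<subseteq> V \<and> real (card {a\<in>E. \<forall>j<l. x a j \<in> C}) < \<epsilon> * D * real N)
      \<and> covers \<C> (\<lambda>I. I \<subseteq> V \<and> tuple_free E x {..<l} I)"
    if hyp: "finite E" "finite V" "card V \<le> N" "0 < N"
      "0 < p" "p \<le> p0" "0 < D" "real q \<le> p * real N" "p * real N \<le> 2 * real q"
      "bounded_codeg E x {..<l} D p"
    for E :: "'e set" and x :: "'e \<Rightarrow> nat \<Rightarrow> 'v" and V N q D p
  proof -
    have all: "\<exists>\<C>. finite \<C> \<and> card \<C> \<le> (N + 1) ^ (l * s * q)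
      \<and> (\<forall>C\<in>\<C>. C \<subseteq> V \<and> real (card {a\<in>E. \<forall>j<l. x a j \<in> C}) < \<epsilon> * D * real N)
      \<and> covers \<C> (\<lambda>I. I \<subseteq> W \<and> tuple_free E x {..<l} I)"
      if "W \<subseteq> V" "real (card W) \<le> real s * \<gamma> * real N" for s W
      using that
    proof (induction s arbitrary: W)
      case 0
      \<comment> \<open>The empty container holds no edge because \<open>l\<close> is
        positive.\<close>
      then have "W = {}" using hyp(2) finite_subset by fastforce
      moreover have "{a\<in>E. \<forall>j<l. x a j \<in> {}} = {}" using assms(1) by auto
      then have "real (card {a\<in>E. \<forall>j<l. x a j \<in> {}}) < \<epsilon> * D * real N"
        using hyp assms by (simp only: card.empty) simp
      ultimately show ?case by (intro exI[of _ "{{}}"]) (simp add: covers_def)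
    next
      case (Suc s)
      let ?E = "{a\<in>E. \<forall>j<l. x a j \<in> W}"
      have finW: "finite W" using Suc.prems hyp finite_subset by blast
      show ?case
      proof (cases "real (card ?E) < \<epsilon> * D * real N")
        case True
        then show ?thesis using Suc.prems by (intro exI[of _ "{W}"]) (auto simp: covers_def)
      next
        case False
        have "bounded_codeg ?E x {..<l} D p"
          unfolding bounded_codeg_def
        proof (intro ballI allI impI)
          fix a J assume a: "a \<in> ?E" "J \<subseteq> {..<l} \<and> J \<noteq> {}"
          have "codeg ?E x J a \<le> codeg E x J a"
            unfolding codeg_def by (rule card_mono) (use hyp in auto)
          moreover have "real (codeg E x J a) \<le> D * p ^ (card J - 1)"
            using a hyp(10) unfolding bounded_codeg_def by blast
          ultimately show "real (codeg ?E x J a) \<le> D * p ^ (card J - 1)" by linarith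
        qed
        moreover have "card W \<le> N" using card_mono[OF hyp(2) Suc.prems(1)] hyp(3) by linarith
        ultimately have "\<exists>\<C>. finite \<C> \<and> card \<C> \<le> (N + 1) ^ (l * q)
          \<and> (\<forall>C\<in>\<C>. C \<subseteq> W \<and> \<gamma> * real N \<le> real (card (W - C)))
          \<and> covers \<C> (\<lambda>I. I \<subseteq> W \<and> tuple_free ?E x {..<l} I)"
          using hyp finW False by (intro step[rule_format, unfolded ll]) auto
        then obtain \<C> where \<C>: "finite \<C>" "card \<C> \<le> (N + 1) ^ (l * q)"
          "\<forall>C\<in>\<C>. C \<subseteq> W \<and> \<gamma> * real N \<le> real (card (W - C))"
          "covers \<C> (\<lambda>I. I \<subseteq> W \<and> tuple_free ?E x {..<l} I)"
          by (elim exE conjE) (rule that; assumption)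
        have sub: "\<exists>\<D>. finite \<D> \<and> card \<D> \<le> (N + 1) ^ (l * s * q)
          \<and> (\<forall>C\<in>\<D>. C \<subseteq> V \<and> real (card {a\<in>E. \<forall>j<l. x a j \<in> C}) < \<epsilon> * D * real N)
          \<and> covers \<D> (\<lambda>I. I \<subseteq> C \<and> tuple_free E x {..<l} I)" if "C \<in> \<C>" for C
        proof (rule Suc.IH)
          have C: "C \<subseteq> W" "\<gamma> * real N \<le> real (card (W - C))" using \<C>(3) that by auto
          then show "C \<subseteq> V" using Suc.prems by blast
          have "real (card (W - C)) = real (card W) - real (card C)"
            using C finW finite_subset[OF C(1) finW] card_mono[OF finW C(1)]
            by (simp add: card_Diff_subset of_nat_diff)
          then show "real (card C) \<le> real s * \<gamma> * real N"
            using C Suc.prems(2) by (simp add: algebra_simps)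
        qed
        have "\<exists>\<D>. \<forall>C\<in>\<C>. finite (\<D> C) \<and> card (\<D> C) \<le> (N + 1) ^ (l * s * q)
          \<and> (\<forall>C\<in>\<D> C. C \<subseteq> V \<and> real (card {a\<in>E. \<forall>j<l. x a j \<in> C}) < \<epsilon> * D * real N)
          \<and> covers (\<D> C) (\<lambda>I. I \<subseteq> C \<and> tuple_free E x {..<l} I)"
          by (rule bchoice, rule ballI, rule sub)
        then obtain \<D> where \<D>: "\<And>C. C \<in> \<C> \<Longrightarrow> finite (\<D> C) \<and> card (\<D> C) \<le> (N + 1) ^ (l * s * q)
          \<and> (\<forall>C\<in>\<D> C. C \<subseteq> V \<and> real (card {a\<in>E. \<forall>j<l. x a j \<in> C}) < \<epsilon> * D * real N)
          \<and> covers (\<D> C) (\<lambda>I. I \<subseteq> C \<and> tuple_free E x {..<l} I)"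
          by blast
        show ?thesis
        proof (intro exI conjI)
          show "finite (\<Union>C\<in>\<C>. \<D> C)" using \<C> \<D> by auto
          have "card (\<Union>C\<in>\<C>. \<D> C) \<le> (\<Sum>C\<in>\<C>. card (\<D> C))" by (rule card_UN_le[OF \<C>(1)])
          also have "\<dots> \<le> (\<Sum>C\<in>\<C>. (N + 1) ^ (l * s * q))" by (rule sum_mono) (use \<D> in auto)
          also have "\<dots> = card \<C> * (N + 1) ^ (l * s * q)" by simp
          also have "\<dots> \<le> (N + 1) ^ (l * q) * (N + 1) ^ (l * s * q)"
            using \<C>(2) by (intro mult_right_mono) auto
          also have "\<dots> = (N + 1) ^ (l * Suc s * q)" by (simp add: algebra_simps flip: power_add)
          finally show "card (\<Union>C\<in>\<C>. \<D> C) \<le> (N + 1) ^ (l * Suc s * q)" .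
          show "\<forall>C\<in>(\<Union>C\<in>\<C>. \<D> C). C \<subseteq> V \<and> real (card {a\<in>E. \<forall>j<l. x a j \<in> C}) < \<epsilon> * D * real N"
            using \<D> by blast
          show "covers (\<Union>C\<in>\<C>. \<D> C) (\<lambda>I. I \<subseteq> W \<and> tuple_free E x {..<l} I)"
            unfolding covers_def
          proof (intro allI impI)
            fix I assume I: "I \<subseteq> W \<and> tuple_free E x {..<l} I"
            then have "tuple_free ?E x {..<l} I" unfolding tuple_free_def by blast
            then obtain C where C: "C \<in> \<C>" "I \<subseteq> C" using \<C>(4) I unfolding covers_def by meson
            have "covers (\<D> C) (\<lambda>I. I \<subseteq> C \<and> tuple_free E x {..<l} I)" using \<D>[OF C(1)] by (elim conjE)
            then obtain C' where "C' \<in> \<D> C" "I \<subseteq> C'" using C I unfolding covers_def by meson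
            then show "\<exists>C\<in>(\<Union>C\<in>\<C>. \<D> C). I \<subseteq> C" using C(1) by (intro bexI[of _ C']) auto
          qed
        qed
      qed
    qed
    have "real (card V) \<le> real t * \<gamma> * real N"
    proof -
      have "1 * real N \<le> real t * \<gamma> * real N" by (rule mult_right_mono) (use t in auto)
      then show ?thesis using hyp(3) by linarith
    qed
    then show ?thesis by (rule all[OF order_refl])
  qed
  show ?thesis
    by (rule exI[of _ "l * t"], rule exI[of _ p0], rule conjI, rule g(2), intro allI impI, rule main; assumption)
qed

section \<open>Janson's inequality\<close>

lemma prob_bernoulli_product_insert:
  assumes "finite A" "u \<notin> A" "0 \<le> p" "p \<le> 1"
  shows "measure_pmf.prob (Pi_pmf (insert u A) False (\<lambda>_. bernoulli_pmf p)) Z =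
    p * measure_pmf.prob (Pi_pmf A False (\<lambda>_. bernoulli_pmf p)) {X. X(u := True) \<in> Z}
    + (1 - p) * measure_pmf.prob (Pi_pmf A False (\<lambda>_. bernoulli_pmf p)) {X. X(u := False) \<in> Z}"
proof -
  let ?M = "Pi_pmf A False (\<lambda>_. bernoulli_pmf p)"
  have eq: "Pi_pmf (insert u A) False (\<lambda>_. bernoulli_pmf p)
      = bernoulli_pmf p \<bind> (\<lambda>y. map_pmf (\<lambda>f. f(u := y)) ?M)"
    using assms by (subst Pi_pmf_insert') (auto simp: map_pmf_def)
  have "emeasure (measure_pmf (Pi_pmf (insert u A) False (\<lambda>_. bernoulli_pmf p))) Z
     = ennreal (p * measure_pmf.prob ?M {X. X(u := True) \<in> Z}
         + (1 - p) * measure_pmf.prob ?M {X. X(u := False) \<in> Z})"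
    unfolding eq emeasure_bind_pmf using assms
    by (simp add: measure_pmf.emeasure_eq_measure vimage_def ennreal_mult' ennreal_plus
        mult.commute)
  then show ?thesis
    using assms by (simp add: measure_pmf.emeasure_eq_measure flip: ennreal_plus)
qed

lemma prob_bernoulli_product_present:
  assumes "finite A" "u \<in> A" "0 \<le> p" "p \<le> 1"
  shows "measure_pmf.prob (Pi_pmf A False (\<lambda>_. bernoulli_pmf p)) {X. X u \<and> X \<in> Z} =
    p * measure_pmf.prob (Pi_pmf A False (\<lambda>_. bernoulli_pmf p)) {X. X(u := True) \<in> Z}"
proof -
  obtain B where B: "A = insert u B" "u \<notin> B" using assms(2) by (meson Set.set_insert)
  then have "finite B" using assms(1) by simp
  note split = prob_bernoulli_product_insert[OF this B(2) assms(3,4)]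
  show ?thesis
    unfolding B(1) split by (simp add: algebra_simps)
qed

text \<open>The special case of Harris' inequality that Janson's inequality needs: conditioning on
  \<open>U\<close> being present amounts to adding \<open>U\<close>.\<close>

lemma prob_bernoulli_product_all_present:
  assumes "finite A" "U \<subseteq> A" "0 \<le> p" "p \<le> 1"
  shows "measure_pmf.prob (Pi_pmf A False (\<lambda>_. bernoulli_pmf p)) {X. (\<forall>u\<in>U. X u) \<and> X \<in> Z} =
    p ^ card U * measure_pmf.prob (Pi_pmf A False (\<lambda>_. bernoulli_pmf p)) {X. (\<lambda>w. w \<in> U \<or> X w) \<in> Z}"
proof -
  have "finite U" using assms finite_subset by blast
  then show ?thesis using assms(2)
  proof (induction U arbitrary: Z)
    case empty
    then show ?case by simp
  next
    case (insert u U)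
    let ?P = "measure_pmf.prob (Pi_pmf A False (\<lambda>_. bernoulli_pmf p))"
    have "?P {X. (\<forall>u\<in>insert u U. X u) \<and> X \<in> Z} = ?P {X. X u \<and> X \<in> {X. (\<forall>u\<in>U. X u) \<and> X \<in> Z}}"
      by (intro arg_cong[where f = ?P]) auto
    also have "\<dots> = p * ?P {X. X(u := True) \<in> {X. (\<forall>u\<in>U. X u) \<and> X \<in> Z}}"
      using insert.prems by (intro prob_bernoulli_product_present) (use assms in auto)
    also have "{X. X(u := True) \<in> {X. (\<forall>u\<in>U. X u) \<and> X \<in> Z}}
        = {X. (\<forall>u\<in>U. X u) \<and> X \<in> {X. X(u := True) \<in> Z}}"
      using insert.hyps by auto
    also have "?P \<dots> = p ^ card U * ?P {X. (\<lambda>w. w \<in> U \<or> X w) \<in> {X. X(u := True) \<in> Z}}"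
      using insert.prems by (intro insert.IH) simp
    also have "{X. (\<lambda>w. w \<in> U \<or> X w) \<in> {X. X(u := True) \<in> Z}} = {X. (\<lambda>w. w \<in> insert u U \<or> X w) \<in> Z}"
    proof -
      have "(\<lambda>w. w \<in> U \<or> X w)(u := True) = (\<lambda>w. w \<in> insert u U \<or> X w)" for X by auto
      then show ?thesis by simp
    qed
    finally show ?case using insert.hyps by simp
  qed
qed

definition avoiding :: "('a \<Rightarrow> 'v set) \<Rightarrow> 'a set \<Rightarrow> ('v \<Rightarrow> bool) set" where
  "avoiding U \<Phi> = {X. \<forall>a\<in>\<Phi>. \<exists>u\<in>U a. \<not> X u}"

text \<open>For events that share an element, the probability that both occur; independent pairs get
  weight 0.\<close>

definition overlap_weight :: "real \<Rightarrow> ('a \<Rightarrow> 'v set) \<Rightarrow> 'a \<Rightarrow> 'a \<Rightarrow> real" where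
  "overlap_weight p U a b = (if U a \<inter> U b = {} then 0 else p ^ card (U a \<union> U b))"

text \<open>With \<open>overlap_weight\<close> this is the Delta term of Janson's inequality. Pairs
  are ordered, so symmetric weights count twice.\<close>

definition off_diagonal_sum :: "('a \<Rightarrow> 'a \<Rightarrow> real) \<Rightarrow> 'a set \<Rightarrow> real" where
  "off_diagonal_sum w S = (\<Sum>a\<in>S. \<Sum>b\<in>S - {a}. w a b)"

lemma off_diagonal_sum_insert:
  assumes "finite S" "b \<notin> S"
  shows "off_diagonal_sum w (insert b S) = off_diagonal_sum w S + (\<Sum>a\<in>S. w a b + w b a)"
proof -
  have "(\<Sum>c\<in>insert b S - {a}. w a c) = w a b + (\<Sum>c\<in>S - {a}. w a c)" if "a \<in> S" for a
  proof -
    have "insert b S - {a} = insert b (S - {a})" using that assms by auto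
    then show ?thesis using assms by simp
  qed
  moreover have "insert b S - {b} = S" using assms by auto
  ultimately show ?thesis
    using assms unfolding off_diagonal_sum_def by (simp add: sum.distrib)
qed

text \<open>Adding \<open>b\<close> removes the outcomes that contain \<open>U b\<close> and avoid
  \<open>\<Phi>\<close>. Among those that avoid only the sets disjoint from \<open>U b\<close>,
  independence gives the factor \<open>p ^ card (U b)\<close>, and each set meeting
  \<open>U b\<close> spoils at most its overlap weight, by the Harris bound. The resulting factor
  \<open>1 - t\<close> is at most \<open>exp (- t)\<close>; negative \<open>t\<close> needs no
  argument beyond nonnegativity of probabilities.\<close>

lemma prob_avoiding_insert:
  assumes "finite A" "finite \<Phi>" "\<And>a. a \<in> insert b \<Phi> \<Longrightarrow> U a \<subseteq> A" "0 \<le> p" "p \<le> 1"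
  defines "P \<equiv> measure_pmf.prob (Pi_pmf A False (\<lambda>_. bernoulli_pmf p))"
  shows "P (avoiding U (insert b \<Phi>))
    \<le> P (avoiding U \<Phi>) * exp (- (p ^ card (U b) - (\<Sum>a\<in>\<Phi>. overlap_weight p U a b)))"
proof -
  define \<Phi>0 where "\<Phi>0 = {a\<in>\<Phi>. U a \<inter> U b = {}}"
  define \<Phi>1 where "\<Phi>1 = {a\<in>\<Phi>. U a \<inter> U b \<noteq> {}}"
  define t where "t = p ^ card (U b) - (\<Sum>a\<in>\<Phi>. overlap_weight p U a b)"
  define B where "B V Z = {X. (\<forall>u\<in>V. X u) \<and> X \<in> Z}" for V :: "'a set" and Z
  have P: "P (B V Z) = p ^ card V * P {X. (\<lambda>w. w \<in> V \<or> X w) \<in> Z}" if "V \<subseteq> A" for V Z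
    unfolding P_def B_def using assms that by (intro prob_bernoulli_product_all_present) auto
  have mono: "P Y \<le> P Z" if "Y \<subseteq> Z" for Y Z
    unfolding P_def using that by (intro measure_pmf.finite_measure_mono) auto
  have fin: "finite \<Phi>1" using assms(2) by (simp add: \<Phi>1_def)
  have sum_eq: "(\<Sum>a\<in>\<Phi>. overlap_weight p U a b) = (\<Sum>a\<in>\<Phi>1. p ^ card (U a \<union> U b))"
    unfolding \<Phi>1_def overlap_weight_def using assms(2)
    by (intro sum.mono_neutral_cong_right) auto
  have first: "P (B (U b) (avoiding U \<Phi>0)) = p ^ card (U b) * P (avoiding U \<Phi>0)"
  proof -
    have "{X. (\<lambda>w. w \<in> U b \<or> X w) \<in> avoiding U \<Phi>0} = avoiding U \<Phi>0"
      unfolding avoiding_def \<Phi>0_def by blast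
    then show ?thesis using P[of "U b" "avoiding U \<Phi>0"] assms(3) by simp
  qed
  have second: "P (B (U a \<union> U b) (avoiding U \<Phi>0)) \<le> p ^ card (U a \<union> U b) * P (avoiding U \<Phi>0)"
    if "a \<in> \<Phi>1" for a
  proof -
    have "U a \<union> U b \<subseteq> A" using that assms(3) unfolding \<Phi>1_def by auto
    moreover have "{X. (\<lambda>w. w \<in> U a \<union> U b \<or> X w) \<in> avoiding U \<Phi>0} \<subseteq> avoiding U \<Phi>0"
      unfolding avoiding_def by blast
    ultimately show ?thesis
      using P mono assms(4) by (simp add: mult_left_mono)
  qed
  have "P (B (U b) (avoiding U \<Phi>0))
      \<le> P (B (U b) (avoiding U \<Phi>) \<union> (\<Union>a\<in>\<Phi>1. B (U a \<union> U b) (avoiding U \<Phi>0)))"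
  proof (rule mono, rule subsetI)
    fix X assume X: "X \<in> B (U b) (avoiding U \<Phi>0)"
    show "X \<in> B (U b) (avoiding U \<Phi>) \<union> (\<Union>a\<in>\<Phi>1. B (U a \<union> U b) (avoiding U \<Phi>0))"
    proof (cases "\<exists>a\<in>\<Phi>1. \<forall>u\<in>U a. X u")
      case True
      then show ?thesis using X unfolding B_def by blast
    next
      case False
      have "\<Phi> = \<Phi>0 \<union> \<Phi>1" unfolding \<Phi>0_def \<Phi>1_def by blast
      then have "X \<in> avoiding U \<Phi>" using False X unfolding B_def avoiding_def by blast
      then show ?thesis using X unfolding B_def by blast
    qed
  qed
  also have "\<dots> \<le> P (B (U b) (avoiding U \<Phi>)) + P (\<Union>a\<in>\<Phi>1. B (U a \<union> U b) (avoiding U \<Phi>0))"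
    unfolding P_def by (intro measure_Un_le) auto
  also have "P (\<Union>a\<in>\<Phi>1. B (U a \<union> U b) (avoiding U \<Phi>0)) \<le> (\<Sum>a\<in>\<Phi>1. P (B (U a \<union> U b) (avoiding U \<Phi>0)))"
    unfolding P_def using fin by (intro measure_pmf.finite_measure_subadditive_finite) auto
  also have "\<dots> \<le> (\<Sum>a\<in>\<Phi>1. p ^ card (U a \<union> U b) * P (avoiding U \<Phi>0))"
    by (rule sum_mono) (rule second)
  also have "\<dots> = (\<Sum>a\<in>\<Phi>. overlap_weight p U a b) * P (avoiding U \<Phi>0)"
    by (simp add: sum_eq sum_distrib_right)
  finally have low: "t * P (avoiding U \<Phi>0) \<le> P (B (U b) (avoiding U \<Phi>))"
    unfolding first t_def by (simp add: algebra_simps)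
  have "t * P (avoiding U \<Phi>) \<le> P (B (U b) (avoiding U \<Phi>))"
  proof (cases "0 \<le> t")
    case True
    have "P (avoiding U \<Phi>) \<le> P (avoiding U \<Phi>0)"
      by (rule mono) (auto simp: avoiding_def \<Phi>0_def)
    then show ?thesis using low True mult_left_mono by (meson order_trans)
  next
    case False
    then have "t * P (avoiding U \<Phi>) \<le> 0" unfolding P_def by (simp add: mult_nonpos_nonneg)
    also have "0 \<le> P (B (U b) (avoiding U \<Phi>))" unfolding P_def by simp
    finally show ?thesis .
  qed
  moreover have "P (avoiding U (insert b \<Phi>)) = P (avoiding U \<Phi>) - P (B (U b) (avoiding U \<Phi>))"
  proof -
    have "avoiding U (insert b \<Phi>) = avoiding U \<Phi> - B (U b) (avoiding U \<Phi>)"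
      unfolding avoiding_def B_def by blast
    moreover have "B (U b) (avoiding U \<Phi>) \<subseteq> avoiding U \<Phi>" unfolding B_def by blast
    ultimately show ?thesis unfolding P_def by (simp add: measure_pmf.finite_measure_Diff)
  qed
  ultimately have "P (avoiding U (insert b \<Phi>)) \<le> P (avoiding U \<Phi>) * (1 - t)"
    by (simp add: algebra_simps)
  also have "\<dots> \<le> P (avoiding U \<Phi>) * exp (- t)"
    using exp_ge_add_one_self[of "- t"] unfolding P_def by (intro mult_left_mono) auto
  finally show ?thesis unfolding t_def .
qed

lemma prob_avoiding_le_exp:
  assumes "finite A" "finite \<Phi>" "\<And>a. a \<in> \<Phi> \<Longrightarrow> U a \<subseteq> A" "0 \<le> p" "p \<le> 1"
  shows "measure_pmf.prob (Pi_pmf A False (\<lambda>_. bernoulli_pmf p)) (avoiding U \<Phi>)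
    \<le> exp (- ((\<Sum>a\<in>\<Phi>. p ^ card (U a)) - off_diagonal_sum (overlap_weight p U) \<Phi>))"
  using assms(2,3)
proof (induction \<Phi>)
  case empty
  then show ?case by (simp add: off_diagonal_sum_def)
next
  case (insert b \<Phi>)
  let ?P = "measure_pmf.prob (Pi_pmf A False (\<lambda>_. bernoulli_pmf p))"
  let ?w = "overlap_weight p U"
  have w0: "0 \<le> ?w a b" for a b using assms(4) by (simp add: overlap_weight_def)
  have "?P (avoiding U (insert b \<Phi>)) \<le> ?P (avoiding U \<Phi>) * exp (- (p ^ card (U b) - (\<Sum>a\<in>\<Phi>. ?w a b)))"
    using insert assms by (intro prob_avoiding_insert) auto
  also have "\<dots> \<le> exp (- ((\<Sum>a\<in>\<Phi>. p ^ card (U a)) - off_diagonal_sum ?w \<Phi>))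
      * exp (- (p ^ card (U b) - (\<Sum>a\<in>\<Phi>. ?w a b)))"
    using insert by (intro mult_right_mono) auto
  \<comment> \<open>The new element enters \<open>off_diagonal_sum\<close> through pairs in both
    orders, of which only one was spent.\<close>
  also have "\<dots> \<le> exp (- ((\<Sum>a\<in>insert b \<Phi>. p ^ card (U a)) - off_diagonal_sum ?w (insert b \<Phi>)))"
    using insert.hyps w0 by (simp add: off_diagonal_sum_insert sum.distrib sum_nonneg flip: exp_add)
  finally show ?case .
qed

text \<open>The right-hand side is the mean of \<open>(\<Sum>a\<in>S. \<alpha> a) - off_diagonal_sum w S\<close> over a random \<open>S\<close>
  containing each point with probability \<open>s\<close>.\<close>

lemma exists_subset_ge_mean:
  fixes s :: real
  assumes "finite \<Phi>" "0 \<le> s" "s \<le> 1"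
  shows "\<exists>S\<subseteq>\<Phi>. (\<Sum>a\<in>S. \<alpha> a) - off_diagonal_sum w S
    \<ge> s * (\<Sum>a\<in>\<Phi>. \<alpha> a) - s\<^sup>2 * off_diagonal_sum w \<Phi>"
  using assms(1)
proof (induction \<Phi> arbitrary: \<alpha>)
  case empty
  then show ?case by (simp add: off_diagonal_sum_def)
next
  case (insert b \<Phi>)
  \<comment> \<open>\<open>\<beta>\<close> charges to each point its interaction with
    \<open>b\<close>, so that the choice containing \<open>b\<close> becomes an instance of the
    induction hypothesis.\<close>
  define \<beta> where "\<beta> a = \<alpha> a - (w a b + w b a)" for a
  define V where "V \<alpha> = s * (\<Sum>a\<in>\<Phi>. \<alpha> a) - s\<^sup>2 * off_diagonal_sum w \<Phi>" for \<alpha>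
  let ?T = "s * (\<Sum>a\<in>insert b \<Phi>. \<alpha> a) - s\<^sup>2 * off_diagonal_sum w (insert b \<Phi>)"
  obtain S1 where S1: "S1 \<subseteq> \<Phi>" "V \<alpha> \<le> (\<Sum>a\<in>S1. \<alpha> a) - off_diagonal_sum w S1"
    using insert.IH[of \<alpha>] unfolding V_def by blast
  obtain S2 where S2: "S2 \<subseteq> \<Phi>" "V \<beta> \<le> (\<Sum>a\<in>S2. \<beta> a) - off_diagonal_sum w S2"
    using insert.IH[of \<beta>] unfolding V_def by blast
  \<comment> \<open>Conditional expectation on whether \<open>b\<close> is chosen. A weighted mean
    does not exceed both of its terms.\<close>
  have T: "?T = (1 - s) * V \<alpha> + s * (\<alpha> b + V \<beta>)"
    using insert.hyps unfolding V_def \<beta>_def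
    by (simp add: off_diagonal_sum_insert sum_subtractf algebra_simps power2_eq_square)
  show ?case
  proof (cases "?T \<le> V \<alpha>")
    case True
    then show ?thesis using S1 by (intro exI[of _ S1]) auto
  next
    case False
    have "?T \<le> \<alpha> b + V \<beta>"
    proof (rule ccontr)
      assume "\<not> ?T \<le> \<alpha> b + V \<beta>"
      then have "s * (\<alpha> b + V \<beta>) \<le> s * ?T" "(1 - s) * V \<alpha> \<le> (1 - s) * ?T"
        using False assms by (auto intro!: mult_left_mono)
      moreover have "s * (\<alpha> b + V \<beta>) < s * ?T \<or> (1 - s) * V \<alpha> < (1 - s) * ?T"
        using False \<open>\<not> ?T \<le> \<alpha> b + V \<beta>\<close> assms by (cases "s = 0") auto
      moreover have "s * ?T + (1 - s) * ?T = ?T" by (simp add: algebra_simps)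
      ultimately show False using T by linarith
    qed
    moreover have "finite S2" "b \<notin> S2" using S2 insert.hyps finite_subset by auto
    then have "(\<Sum>a\<in>insert b S2. \<alpha> a) - off_diagonal_sum w (insert b S2)
        = \<alpha> b + ((\<Sum>a\<in>S2. \<beta> a) - off_diagonal_sum w S2)"
      by (simp add: off_diagonal_sum_insert \<beta>_def sum_subtractf)
    ultimately show ?thesis using S2 by (intro exI[of _ "insert b S2"]) auto
  qed
qed

text \<open>\<open>prob_avoiding_le_exp\<close> says nothing once the overlaps exceed the mean.
  Passing to a subfamily of density \<open>s\<close> scales the mean by \<open>s\<close> but the
  overlaps by \<open>s ^ 2\<close>, so a suitable \<open>s\<close> restores a useful bound.\<close>

theorem janson_inequality:
  fixes s :: real
  assumes "finite A" "finite \<Phi>" "\<And>a. a \<in> \<Phi> \<Longrightarrow> U a \<subseteq> A" "0 \<le> p" "p \<le> 1" "0 \<le> s" "s \<le> 1"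
  shows "measure_pmf.prob (Pi_pmf A False (\<lambda>_. bernoulli_pmf p)) (avoiding U \<Phi>)
    \<le> exp (- (s * (\<Sum>a\<in>\<Phi>. p ^ card (U a)) - s\<^sup>2 * off_diagonal_sum (overlap_weight p U) \<Phi>))"
proof -
  obtain S where S: "S \<subseteq> \<Phi>"
    "s * (\<Sum>a\<in>\<Phi>. p ^ card (U a)) - s\<^sup>2 * off_diagonal_sum (overlap_weight p U) \<Phi>
      \<le> (\<Sum>a\<in>S. p ^ card (U a)) - off_diagonal_sum (overlap_weight p U) S"
    using exists_subset_ge_mean[OF assms(2,6,7), where \<alpha> = "\<lambda>a. p ^ card (U a)"] by meson
  let ?P = "measure_pmf.prob (Pi_pmf A False (\<lambda>_. bernoulli_pmf p))"
  have "?P (avoiding U \<Phi>) \<le> ?P (avoiding U S)"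
    by (rule measure_pmf.finite_measure_mono) (use S in \<open>auto simp: avoiding_def\<close>)
  also have "\<dots> \<le> exp (- ((\<Sum>a\<in>S. p ^ card (U a)) - off_diagonal_sum (overlap_weight p U) S))"
    by (rule prob_avoiding_le_exp) (use assms S finite_subset[OF S(1)] in auto)
  also have "\<dots> \<le> exp (- (s * (\<Sum>a\<in>\<Phi>. p ^ card (U a)) - s\<^sup>2 * off_diagonal_sum (overlap_weight p U) \<Phi>))"
    using S(2) by simp
  finally show ?thesis .
qed

section \<open>Embeddings and Ramsey supersaturation\<close>

definition embeddings :: "'a hypergraph \<Rightarrow> nat \<Rightarrow> ('a \<Rightarrow> nat) set" where
  "embeddings F n = {\<phi> \<in> verts F \<rightarrow>\<^sub>E {1..n}. inj_on \<phi> (verts F)}"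

definition embeddings_in :: "'a hypergraph \<Rightarrow> nat \<Rightarrow> nat set set \<Rightarrow> ('a \<Rightarrow> nat) set" where
  "embeddings_in F n K = {\<phi> \<in> embeddings F n. \<forall>e\<in>edges F. \<phi> ` e \<in> K}"

lemma finite_embeddings: "finite (verts F) \<Longrightarrow> finite (embeddings F n)"
  unfolding embeddings_def by (simp add: finite_PiE)

lemma embeddings_in_subset: "embeddings_in F n K \<subseteq> embeddings F n"
  unfolding embeddings_in_def by blast

text \<open>Injectivity is simply dropped. With \<open>Y\<close> the image of another embedding,
  this bounds both the codegrees for containers and the overlaps for Janson's inequality.\<close>

lemma card_embeddings_into_le:
  assumes "finite (verts F)" "W \<subseteq> verts F" "finite Y"
  shows "card {\<psi> \<in> embeddings F n. \<psi> ` W \<subseteq> Y} \<le> card Y ^ card W * n ^ (card (verts F) - card W)"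
proof -
  let ?B = "\<lambda>a. if a \<in> W then Y else {1..n}"
  have "card {\<psi> \<in> embeddings F n. \<psi> ` W \<subseteq> Y} \<le> card (PiE (verts F) ?B)"
  proof (rule card_mono)
    show "finite (PiE (verts F) ?B)" using assms by (intro finite_PiE) auto
    show "{\<psi> \<in> embeddings F n. \<psi> ` W \<subseteq> Y} \<subseteq> PiE (verts F) ?B"
      unfolding embeddings_def by (auto simp: PiE_def Pi_def)
  qed
  also have "\<dots> = (\<Prod>a\<in>verts F. if a \<in> W then card Y else n)"
    using assms by (simp add: card_PiE if_distrib[of card] cong: if_cong)
  also have "\<dots> = card Y ^ card W * n ^ (card (verts F) - card W)"
  proof -
    have "verts F \<inter> {a. a \<in> W} = W" "verts F \<inter> - {a. a \<in> W} = verts F - W" using assms by auto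
    then show ?thesis
      using assms finite_subset[OF assms(2)] by (simp add: prod.If_cases card_Diff_subset)
  qed
  finally show ?thesis .
qed

lemma card_embeddings_le:
  assumes "finite (verts F)"
  shows "card (embeddings F n) \<le> n ^ card (verts F)"
  using card_embeddings_into_le[OF assms, of "{}" "{}" n] by simp

lemma card_injections_ge:
  assumes "2 * m \<le> n"
  shows "(real n / 2) ^ m \<le> real (card {g \<in> {..<m} \<rightarrow>\<^sub>E {1..n}. inj_on g {..<m}})"
proof -
  have "card {g \<in> {..<m} \<rightarrow>\<^sub>E {1..n}. inj_on g {..<m}} = (\<Prod>i<m. n - i)"
    using card_inj_on_subset_funcset[of "{..<m}" "{1..n}" "{..<m}"]
    by (simp add: lessThan_atLeast0)
  moreover have "(real n / 2) ^ m = (\<Prod>i<m. real n / 2)" by simp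
  moreover have "\<dots> \<le> (\<Prod>i<m. real (n - i))"
    by (rule prod_mono) (use assms in auto)
  ultimately show ?thesis by simp
qed

lemma card_extensions_le:
  assumes "finite V" "finite M" "h \<in> V \<rightarrow>\<^sub>E M" "inj_on h V" "finite \<Psi>"
  shows "card {g \<in> M \<rightarrow>\<^sub>E {1..n::nat}. restrict (g \<circ> h) V \<in> \<Psi>} \<le> card \<Psi> * n ^ (card M - card V)"
proof -
  let ?R = "M - h ` V"
  have hV: "h ` V \<subseteq> M" using assms(3) by auto
  have "card {g \<in> M \<rightarrow>\<^sub>E {1..n}. restrict (g \<circ> h) V \<in> \<Psi>} \<le> card (\<Psi> \<times> (?R \<rightarrow>\<^sub>E {1..n}))"
  proof (rule card_inj_on_le)
    show "inj_on (\<lambda>g. (restrict (g \<circ> h) V, restrict g ?R)) {g \<in> M \<rightarrow>\<^sub>E {1..n}. restrict (g \<circ> h) V \<in> \<Psi>}"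
    proof (rule inj_onI)
      fix g g' assume g: "g \<in> {g \<in> M \<rightarrow>\<^sub>E {1..n}. restrict (g \<circ> h) V \<in> \<Psi>}"
        "g' \<in> {g \<in> M \<rightarrow>\<^sub>E {1..n}. restrict (g \<circ> h) V \<in> \<Psi>}"
        and eq: "(restrict (g \<circ> h) V, restrict g ?R) = (restrict (g' \<circ> h) V, restrict g' ?R)"
      have "g y = g' y" if "y \<in> M" for y
      proof (cases "y \<in> h ` V")
        case True
        then obtain a where "a \<in> V" "y = h a" by blast
        moreover have "restrict (g \<circ> h) V a = restrict (g' \<circ> h) V a" using eq by (metis prod.inject)
        ultimately show ?thesis by simp
      next
        case False
        moreover have "restrict g ?R y = restrict g' ?R y" using eq by (metis prod.inject)
        ultimately show ?thesis using that by simp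
      qed
      then show "g = g'" using g by (intro PiE_ext[of g M "\<lambda>_. {1..n}" g']) auto
    qed
    show "finite (\<Psi> \<times> (?R \<rightarrow>\<^sub>E {1..n}))" using assms by (auto intro!: finite_PiE)
  qed (auto simp: PiE_def)
  also have "\<dots> = card \<Psi> * n ^ (card M - card V)"
    using assms hV finite_subset[OF hV] by (simp add: card_cartesian_product card_PiE card_Diff_subset card_image)
  finally show ?thesis .
qed

text \<open>Ramsey's theorem, pulled back along an injection \<open>g\<close> of \<open>m\<close>
  points into \<open>{1..n}\<close>, yields a clique with as many vertices as \<open>F i\<close> in
  some class \<open>i\<close>, hence an embedding of \<open>F i\<close> that factors through
  \<open>g\<close>. Each embedding arises from few \<open>g\<close>, so averaging over all
  \<open>g\<close> gives a positive proportion.\<close>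

theorem ramsey_supersaturation:
  fixes F :: "nat \<Rightarrow> 'a hypergraph"
  assumes unif: "\<And>i. i \<in> {1..r} \<Longrightarrow> uniform_hypergraph k (F i)"
  shows "\<exists>\<delta>>0. \<exists>n0. \<forall>n\<ge>n0. \<forall>C. k_sets k n \<subseteq> (\<Union>i\<in>{1..r}. C i) \<longrightarrow>
    (\<exists>i\<in>{1..r}. \<delta> * real n ^ card (verts (F i)) \<le> real (card (embeddings_in (F i) n (C i))))"
proof -
  \<comment> \<open>List positions start at 0 and colours at 1, hence the \<open>Suc\<close> here
    and the subtraction of 1 from \<open>col\<close> below.\<close>
  define qs where "qs = map (\<lambda>i. card (verts (F (Suc i)))) [0..<r]"
  obtain m :: nat where m: "partn_lst {..<m} qs k" using ramsey_full[of qs k] by blast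
  define Hs where "Hs i = {h \<in> verts (F i) \<rightarrow>\<^sub>E {..<m}. inj_on h (verts (F i))}" for i
  define s where "s = (\<Sum>i\<in>{1..r}. card (Hs i))"
  \<comment> \<open>There are at least \<open>(n / 2) ^ m\<close> injections, and at most
    \<open>s * \<delta> * n ^ m\<close> if every class is poor. This choice makes the latter
    \<open>s / (s + 1)\<close> times the former, a contradiction.\<close>
  define \<delta> :: real where "\<delta> = 1 / (2 ^ m * (real s + 1))"
  have fin: "finite (verts (F i))" if "i \<in> {1..r}" for i
    using unif[OF that] unfolding uniform_hypergraph_def by simp
  have finHs: "finite (Hs i)" if "i \<in> {1..r}" for i
    unfolding Hs_def using fin[OF that] by (simp add: finite_PiE)
  have main: "\<exists>i\<in>{1..r}. \<delta> * real n ^ card (verts (F i)) \<le> real (card (embeddings_in (F i) n (C i)))"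
    if n: "2 * m + 1 \<le> n" and C: "k_sets k n \<subseteq> (\<Union>i\<in>{1..r}. C i)" for n C
  proof (rule ccontr)
    assume "\<not> ?thesis"
    then have small: "real (card (embeddings_in (F i) n (C i))) < \<delta> * real n ^ card (verts (F i))"
      if "i \<in> {1..r}" for i using that by (meson not_le)
    define G where "G = {g \<in> {..<m} \<rightarrow>\<^sub>E {1..n}. inj_on g {..<m}}"
    define X where "X i h = {g \<in> {..<m} \<rightarrow>\<^sub>E {1..n}. restrict (g \<circ> h) (verts (F i)) \<in> embeddings_in (F i) n (C i)}"
      for i h
    \<comment> \<open>The classes may overlap, so a colouring is obtained by choosing one class for
      each \<open>k\<close>-set.\<close>
    have "\<forall>e\<in>k_sets k n. \<exists>i. i \<in> {1..r} \<and> e \<in> C i" using C by blast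
    then obtain col where col: "\<And>e. e \<in> k_sets k n \<Longrightarrow> col e \<in> {1..r} \<and> e \<in> C (col e)" by metis
    have "G \<subseteq> (\<Union>i\<in>{1..r}. \<Union>h\<in>Hs i. X i h)"
    proof
      fix g assume "g \<in> G"
      then have g: "g \<in> {..<m} \<rightarrow>\<^sub>E {1..n}" "inj_on g {..<m}" unfolding G_def by auto
      have gk: "g ` e \<in> k_sets k n" if "e \<in> nsets {..<m} k" for e
        using that g unfolding nsets_def k_sets_def by (auto simp: card_image inj_on_subset)
      have "(\<lambda>e. col (g ` e) - 1) \<in> nsets {..<m} k \<rightarrow> {..<length qs}"
      proof
        fix e assume "e \<in> nsets {..<m} k"
        then show "col (g ` e) - 1 \<in> {..<length qs}" using col[OF gk] unfolding qs_def by fastforce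
      qed
      then obtain i H where i: "i < length qs" and H: "H \<in> nsets {..<m} (qs ! i)"
        "(\<lambda>e. col (g ` e) - 1) ` nsets H k \<subseteq> {i}"
        using partn_lstE[OF m] by metis
      have ir: "Suc i \<in> {1..r}" and qi: "qs ! i = card (verts (F (Suc i)))"
        using i unfolding qs_def by auto
      let ?V = "verts (F (Suc i))"
      have "finite H" "card H = card ?V" "H \<subseteq> {..<m}" using H(1) qi unfolding nsets_def by auto
      then obtain h0 where h0: "bij_betw h0 ?V H"
        using finite_same_card_bij[OF fin[OF ir]] by metis
      define h where "h = restrict h0 ?V"
      have hV: "h ` ?V = H" "inj_on h ?V" using h0 unfolding h_def bij_betw_def by (auto simp: inj_on_def)
      have h: "h \<in> Hs (Suc i)"
        using hV \<open>H \<subseteq> {..<m}\<close> unfolding Hs_def h_def by auto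
      have emb: "restrict (g \<circ> h) ?V \<in> embeddings (F (Suc i)) n"
      proof -
        have "inj_on (g \<circ> h) ?V"
          using hV g(2) \<open>H \<subseteq> {..<m}\<close> by (intro comp_inj_on) (auto intro: inj_on_subset)
        moreover have "(g \<circ> h) a \<in> {1..n}" if "a \<in> ?V" for a
          using that hV(1) \<open>H \<subseteq> {..<m}\<close> g(1) by (auto simp: PiE_def Pi_def)
        ultimately show ?thesis unfolding embeddings_def by (auto simp: inj_on_def)
      qed
      moreover have "restrict (g \<circ> h) ?V ` e \<in> C (Suc i)" if "e \<in> edges (F (Suc i))" for e
      proof -
        have e: "e \<subseteq> ?V" "card e = k" using unif[OF ir] that unfolding uniform_hypergraph_def by auto
        have he: "h ` e \<in> nsets H k"
          using e hV fin[OF ir] finite_subset unfolding nsets_def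
          by (auto simp: card_image inj_on_subset)
        then have he': "h ` e \<in> nsets {..<m} k" using \<open>H \<subseteq> {..<m}\<close> nsets_mono by blast
        have "col (g ` h ` e) - 1 = i" using he H(2) by blast
        then have "col (g ` h ` e) = Suc i" using col[OF gk[OF he']] by auto
        then have "g ` h ` e \<in> C (Suc i)" using col[OF gk[OF he']] by auto
        moreover have "restrict (g \<circ> h) ?V ` e = g ` h ` e" using e(1) by (auto simp: image_iff subset_iff)
        ultimately show ?thesis by simp
      qed
      ultimately have "g \<in> X (Suc i) h" using g(1) unfolding X_def embeddings_in_def by blast
      then show "g \<in> (\<Union>i\<in>{1..r}. \<Union>h\<in>Hs i. X i h)" using ir h by blast
    qed
    moreover have finX: "finite (X i h)" for i h
      by (rule finite_subset[of _ "{..<m} \<rightarrow>\<^sub>E {1..n}"]) (auto simp: X_def finite_PiE)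
    ultimately have "card G \<le> card (\<Union>i\<in>{1..r}. \<Union>h\<in>Hs i. X i h)"
      using finHs by (intro card_mono) auto
    also have "\<dots> \<le> (\<Sum>i\<in>{1..r}. card (\<Union>h\<in>Hs i. X i h))" by (intro card_UN_le) auto
    also have "\<dots> \<le> (\<Sum>i\<in>{1..r}. \<Sum>h\<in>Hs i. card (X i h))"
      using finHs by (intro sum_mono card_UN_le) auto
    finally have "real (card G) \<le> (\<Sum>i\<in>{1..r}. \<Sum>h\<in>Hs i. real (card (X i h)))"
      by (simp flip: of_nat_sum)
    also have "\<dots> \<le> (\<Sum>i\<in>{1..r}. \<Sum>h\<in>Hs i. \<delta> * real n ^ m)"
    proof (intro sum_mono)
      fix i h assume i: "i \<in> {1..r}" and h: "h \<in> Hs i"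
      have h': "h \<in> verts (F i) \<rightarrow>\<^sub>E {..<m}" "inj_on h (verts (F i))" using h unfolding Hs_def by auto
      have vm: "card (verts (F i)) \<le> m"
        using card_inj_on_le[OF h'(2), of "{..<m}"] h'(1) by auto
      have "card (X i h) \<le> card (embeddings_in (F i) n (C i)) * n ^ (card {..<m} - card (verts (F i)))"
        unfolding X_def
        by (rule card_extensions_le)
           (use fin[OF i] h' finite_subset[OF embeddings_in_subset finite_embeddings[OF fin[OF i]]] in auto)
      then have "real (card (X i h)) \<le> real (card (embeddings_in (F i) n (C i))) * real n ^ (m - card (verts (F i)))"
        by (simp flip: of_nat_mult of_nat_power)
      also have "\<dots> \<le> \<delta> * real n ^ card (verts (F i)) * real n ^ (m - card (verts (F i)))"
        using small[OF i] by (intro mult_right_mono) auto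
      also have "\<dots> = \<delta> * real n ^ m" using vm by (simp flip: power_add)
      finally show "real (card (X i h)) \<le> \<delta> * real n ^ m" .
    qed
    also have "\<dots> = real s * (\<delta> * real n ^ m)" unfolding s_def by (simp add: sum_distrib_right)
    also have "\<dots> = real s / (real s + 1) * (real n / 2) ^ m"
      unfolding \<delta>_def by (simp add: power_divide)
    also have "\<dots> < 1 * (real n / 2) ^ m"
      using n by (intro mult_strict_right_mono) auto
    also have "\<dots> \<le> real (card G)" unfolding G_def using card_injections_ge[of m n] n by simp
    finally show False by simp
  qed
  have "0 < \<delta>" unfolding \<delta>_def by simp
  then show ?thesis using main by blast
qed

section \<open>Densities\<close>

lemma finite_edges: "uniform_hypergraph k F \<Longrightarrow> finite (edges F)"
  unfolding uniform_hypergraph_def by (metis PowI finite_Pow_iff finite_subset subsetI)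

lemma finite_subhypergraphs:
  assumes "uniform_hypergraph k F"
  shows "finite {H. subhypergraph H F}"
proof (rule finite_subset)
  show "{H. subhypergraph H F} \<subseteq> (\<lambda>(A, B). Hypergraph A B) ` (Pow (verts F) \<times> Pow (edges F))"
  proof
    fix H assume "H \<in> {H. subhypergraph H F}"
    then have "H = (\<lambda>(A, B). Hypergraph A B) (verts H, edges H)"
      "(verts H, edges H) \<in> Pow (verts F) \<times> Pow (edges F)"
      unfolding subhypergraph_def by auto
    then show "H \<in> (\<lambda>(A, B). Hypergraph A B) ` (Pow (verts F) \<times> Pow (edges F))" by blast
  qed
  show "finite ((\<lambda>(A, B). Hypergraph A B) ` (Pow (verts F) \<times> Pow (edges F)))"
    using assms finite_edges[OF assms] unfolding uniform_hypergraph_def by auto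
qed

lemma k_density_le_max:
  assumes "uniform_hypergraph k F" "subhypergraph H F"
  shows "k_density k H \<le> max_k_density k F"
  unfolding max_k_density_def using finite_subhypergraphs[OF assms(1)] assms(2)
  by (intro Max_ge) (auto simp: setcompr_eq_image)

lemma max_k_density_pos_imp:
  assumes "uniform_hypergraph k F" "0 < max_k_density k F"
  shows "edges F \<noteq> {}" "0 < k"
proof -
  have "max_k_density k F \<in> {k_density k H | H. subhypergraph H F}"
    unfolding max_k_density_def
  proof (rule Max_in)
    show "finite {k_density k H | H. subhypergraph H F}"
      using finite_subhypergraphs[OF assms(1)] by (simp add: setcompr_eq_image)
    have "subhypergraph (Hypergraph {} {}) F" unfolding subhypergraph_def by simp
    then show "{k_density k H | H. subhypergraph H F} \<noteq> {}" by blast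
  qed
  then obtain H where H: "subhypergraph H F" "0 < k_density k H" using assms(2) by auto
  have HF: "edges H \<subseteq> edges F" using H(1) unfolding subhypergraph_def by simp
  have ne: "card (edges H) \<noteq> 0" using H(2) unfolding k_density_def by (auto split: if_splits)
  then show "edges F \<noteq> {}" using HF by auto
  show "0 < k"
  proof (rule ccontr)
    assume "\<not> 0 < k"
    \<comment> \<open>For \<open>k = 0\<close> the only possible edge is the empty set, and a single
      edge then has density 0: division by zero gives 0 in the first case of
      \<open>k_density\<close>, and the numerator vanishes in the other.\<close>
    then have "e = {}" if "e \<in> edges F" for e
      using assms(1) that finite_subset[of e "verts F"] unfolding uniform_hypergraph_def by auto
    then have "edges H \<subseteq> {{}}" using HF by auto
    then have "card (edges H) \<le> 1" using card_mono[of "{{}}" "edges H"] by simp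
    then have "card (edges H) = 1" using ne by simp
    then show False using H(2) \<open>\<not> 0 < k\<close> unfolding k_density_def by (simp split: if_splits)
  qed
qed

lemma subhypergraph_spanned:
  assumes "uniform_hypergraph k F" "J \<subseteq> edges F"
  shows "subhypergraph (Hypergraph (\<Union>J) J) F"
  using assms unfolding subhypergraph_def uniform_hypergraph_def by auto

lemma card_spanned_ge:
  assumes "uniform_hypergraph k F" "J \<subseteq> edges F" "J \<noteq> {}"
  shows "k \<le> card (\<Union>J)" "card (\<Union>J) \<le> card (verts F)"
proof -
  have sub: "\<Union>J \<subseteq> verts F" and fin: "finite (verts F)"
    using assms unfolding uniform_hypergraph_def by auto
  then show "card (\<Union>J) \<le> card (verts F)" by (rule card_mono[rotated])
  obtain e where "e \<in> J" using assms by blast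
  then have "card e = k" "e \<subseteq> \<Union>J" using assms unfolding uniform_hypergraph_def by auto
  then show "k \<le> card (\<Union>J)" using card_mono[OF finite_subset[OF sub fin]] by auto
qed

text \<open>A single edge attains this value. It is needed to know that the exponent
  \<open>k - 1 / m\<close> is nonnegative.\<close>

lemma max_k_density_ge:
  assumes "uniform_hypergraph k F" "edges F \<noteq> {}"
  shows "1 / real k \<le> max_k_density k F"
proof -
  obtain e where e: "e \<in> edges F" using assms by blast
  then have "subhypergraph (Hypergraph e {e}) F"
    using subhypergraph_spanned[OF assms(1), of "{e}"] by simp
  moreover have "k_density k (Hypergraph e {e}) = 1 / real k"
    using e assms(1) unfolding k_density_def uniform_hypergraph_def by simp
  ultimately show ?thesis using k_density_le_max[OF assms(1)] by metis
qed

text \<open>Multiplying out \<open>k_density\<close> is legitimate because two distinct edges span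
  more than \<open>k\<close> vertices; for a single edge both sides are 0.\<close>

lemma spanned_density_le:
  assumes F: "uniform_hypergraph k F" and J: "J \<subseteq> edges F" "J \<noteq> {}"
  shows "real (card J) - 1 \<le> max_k_density k F * (real (card (\<Union>J)) - real k)"
proof -
  have finJ: "finite J" using J finite_edges[OF F] finite_subset by blast
  have k: "\<And>e. e \<in> J \<Longrightarrow> card e = k" and sub: "\<Union>J \<subseteq> verts F" and fin: "finite (verts F)"
    using F J unfolding uniform_hypergraph_def by auto
  show ?thesis
  proof (cases "card J = 1")
    case True
    then obtain e where "J = {e}" using card_1_singletonE by blast
    then show ?thesis using k by simp
  next
    case False
    moreover have "card J \<noteq> 0" using finJ J by simp
    ultimately have "card J \<ge> 2" by linarith
    have "card (\<Union>J) \<noteq> k"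
    proof
      assume eq: "card (\<Union>J) = k"
      have "e = \<Union>J" if "e \<in> J" for e
        by (rule card_subset_eq) (use that k eq finite_subset[OF sub fin] in auto)
      then have "J \<subseteq> {\<Union>J}" by blast
      then have "card J \<le> 1" using card_mono[of "{\<Union>J}" J] by simp
      then show False using \<open>card J \<ge> 2\<close> by simp
    qed
    then have gt: "k < card (\<Union>J)" using card_spanned_ge[OF F J] by simp
    have "k_density k (Hypergraph (\<Union>J) J) \<le> max_k_density k F"
      using k_density_le_max[OF F subhypergraph_spanned[OF F J(1)]] .
    moreover have "k_density k (Hypergraph (\<Union>J) J) = (real (card J) - 1) / (real (card (\<Union>J)) - real k)"
      using False \<open>card J \<ge> 2\<close> unfolding k_density_def by simp
    ultimately show ?thesis using gt by (simp add: pos_divide_le_eq)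
  qed
qed

text \<open>Rearranged so that the exponent of \<open>n\<close> in the expected count of a subgraph
  of \<open>F\<close> can be read off. Every edge set spans at least \<open>k\<close> vertices, so
  the denominator is positive.\<close>

lemma asym_k_density_spanned:
  assumes F: "uniform_hypergraph k F" and m: "0 < max_k_density k F'"
    and J: "J \<subseteq> edges F" "J \<noteq> {}"
  shows "0 < asym_k_density k F F'"
    "real (card J) / asym_k_density k F F' \<le> real (card (\<Union>J)) - real k + 1 / max_k_density k F'"
proof -
  define d where "d H = real (card (edges H)) / (real (card (verts H)) - real k + 1 / max_k_density k F')"
    for H :: "'a hypergraph"
  have finJ: "finite J" using J finite_edges[OF F] finite_subset by blast
  then have cJ: "1 \<le> card J" using J by (simp add: Suc_leI card_gt_0_iff)
  have den: "0 < real (card (\<Union>J)) - real k + 1 / max_k_density k F'"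
    using card_spanned_ge(1)[OF F J] m by (simp add: add_nonneg_pos)
  have "d (Hypergraph (\<Union>J) J) \<le> asym_k_density k F F'"
    unfolding asym_k_density_def d_def[symmetric]
  proof (rule Max_ge)
    show "finite {d H |H. subhypergraph H F \<and> 1 \<le> card (edges H)}"
      using finite_subhypergraphs[OF F] by (simp add: setcompr_eq_image)
    show "d (Hypergraph (\<Union>J) J) \<in> {d H |H. subhypergraph H F \<and> 1 \<le> card (edges H)}"
      using subhypergraph_spanned[OF F J(1)] cJ by force
  qed
  then have le: "real (card J) / (real (card (\<Union>J)) - real k + 1 / max_k_density k F') \<le> asym_k_density k F F'"
    unfolding d_def by simp
  moreover have "0 < real (card J) / (real (card (\<Union>J)) - real k + 1 / max_k_density k F')"
    using den cJ by simp
  ultimately show pos: "0 < asym_k_density k F F'" by linarith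
  show "real (card J) / asym_k_density k F F' \<le> real (card (\<Union>J)) - real k + 1 / max_k_density k F'"
    using le den pos by (simp add: pos_divide_le_eq mult.commute)
qed

lemma card_k_sets_le: "card (k_sets k n) \<le> n ^ k"
proof -
  have "card (k_sets k n) = n choose k" unfolding k_sets_def by (simp add: n_subsets)
  then show ?thesis by (cases "k \<le> n") (auto simp: binomial_le_pow binomial_eq_0)
qed

lemma finite_k_sets: "finite (k_sets k n)"
  unfolding k_sets_def by simp

lemma embedding_edge_in_k_sets:
  assumes "uniform_hypergraph k F" "\<phi> \<in> embeddings F n" "e \<in> edges F"
  shows "\<phi> ` e \<in> k_sets k n"
proof -
  have "e \<subseteq> verts F" "card e = k" using assms unfolding uniform_hypergraph_def by auto
  then show ?thesis using assms(2) unfolding embeddings_def k_sets_def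
    by (auto simp: card_image inj_on_subset)
qed

section \<open>Containers for hypergraphs without a copy of \<open>F\<close>\<close>

text \<open>Embeddings with the same image edges on \<open>J\<close> map the set \<open>W\<close>
  spanned by these edges into one fixed set of \<open>card W\<close> points, which leaves at most
  \<open>v ^ v * n ^ (v - card W)\<close> of them. The density gives
  \<open>card W \<ge> k + (card J - 1) / m\<close>. Edges are compared as sets, so \<open>W\<close>
  may be permuted, hence the factor \<open>v ^ v\<close>.\<close>

lemma bounded_codeg_embeddings:
  assumes F: "uniform_hypergraph k F" and m: "0 < max_k_density k F" and n: "1 \<le> n"
    and es: "bij_betw es {..<card (edges F)} (edges F)"
  shows "bounded_codeg (embeddings F n) (\<lambda>\<phi> j. \<phi> ` es j) {..<card (edges F)}
    (real (card (verts F) ^ card (verts F)) * real n powr (real (card (verts F)) - real k))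
    (real n powr (- 1 / max_k_density k F))"
  unfolding bounded_codeg_def
proof (intro ballI allI impI)
  fix \<phi> J assume \<phi>: "\<phi> \<in> embeddings F n" and J: "J \<subseteq> {..<card (edges F)} \<and> J \<noteq> {}"
  let ?m = "max_k_density k F" and ?v = "card (verts F)"
  define W where "W = \<Union>(es ` J)"
  have fin: "finite (verts F)" using F unfolding uniform_hypergraph_def by simp
  have esJ: "es ` J \<subseteq> edges F" "es ` J \<noteq> {}" "card (es ` J) = card J"
    using es J unfolding bij_betw_def by (auto simp: card_image inj_on_subset)
  have WV: "W \<subseteq> verts F" using esJ F unfolding W_def uniform_hypergraph_def by auto
  have Wv: "k \<le> card W" "card W \<le> ?v" using card_spanned_ge[OF F esJ(1,2)] unfolding W_def by auto
  have finW: "finite W" using WV fin finite_subset by blast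
  have cardJ: "1 \<le> card J" using J finite_subset[of J "{..<card (edges F)}"] by (simp add: Suc_leI card_gt_0_iff)
  have "codeg (embeddings F n) (\<lambda>\<phi> j. \<phi> ` es j) J \<phi> \<le> card {\<psi> \<in> embeddings F n. \<psi> ` W \<subseteq> \<phi> ` W}"
    unfolding codeg_def
  proof (rule card_mono)
    show "finite {\<psi> \<in> embeddings F n. \<psi> ` W \<subseteq> \<phi> ` W}" using finite_embeddings[OF fin] by simp
    show "{\<psi> \<in> embeddings F n. \<forall>j\<in>J. \<psi> ` es j = \<phi> ` es j} \<subseteq> {\<psi> \<in> embeddings F n. \<psi> ` W \<subseteq> \<phi> ` W}"
      unfolding W_def by blast
  qed
  also have "\<dots> \<le> card (\<phi> ` W) ^ card W * n ^ (?v - card W)"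
    by (rule card_embeddings_into_le[OF fin WV]) (use finW in simp)
  also have "\<dots> \<le> ?v ^ ?v * n ^ (?v - card W)"
  proof (rule mult_right_mono)
    show "card (\<phi> ` W) ^ card W \<le> ?v ^ ?v"
    proof (cases "?v = 0")
      case True
      then show ?thesis using Wv by simp
    next
      case False
      have "card (\<phi> ` W) ^ card W \<le> ?v ^ card W"
        using card_image_le[OF finW, of \<phi>] Wv by (intro power_mono) auto
      also have "\<dots> \<le> ?v ^ ?v" using False Wv by (intro power_increasing) auto
      finally show ?thesis .
    qed
  qed simp
  finally have "real (codeg (embeddings F n) (\<lambda>\<phi> j. \<phi> ` es j) J \<phi>)
      \<le> real (?v ^ ?v) * real n ^ (?v - card W)"
    by (simp flip: of_nat_power of_nat_mult)
  also have "real n ^ (?v - card W) = real n powr (real ?v - real (card W))"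
    using n Wv by (simp add: powr_realpow[symmetric] of_nat_diff)
  also have "\<dots> \<le> real n powr (real ?v - real k - (real (card J) - 1) / ?m)"
  proof (rule powr_mono)
    have "real (card J) - 1 \<le> ?m * (real (card W) - real k)"
      using spanned_density_le[OF F esJ(1,2)] esJ(3) unfolding W_def by simp
    then have "(real (card J) - 1) / ?m \<le> real (card W) - real k"
      using m by (simp add: pos_divide_le_eq mult.commute)
    then show "real ?v - real (card W) \<le> real ?v - real k - (real (card J) - 1) / ?m" by simp
  qed (use n in simp)
  also have "\<dots> = real n powr (real ?v - real k) * (real n powr (- 1 / ?m)) ^ (card J - 1)"
    using n cardJ by (simp add: powr_realpow[symmetric] powr_powr of_nat_diff flip: powr_add)
  finally show "real (codeg (embeddings F n) (\<lambda>\<phi> j. \<phi> ` es j) J \<phi>)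
      \<le> real (?v ^ ?v) * real n powr (real ?v - real k) * (real n powr (- 1 / ?m)) ^ (card J - 1)"
    by (simp add: mult_left_mono mult.assoc)
qed

theorem hypergraph_containers:
  fixes F :: "'a hypergraph" and \<epsilon> :: real
  assumes F: "uniform_hypergraph k F" and m: "0 < max_k_density k F" and \<epsilon>: "0 < \<epsilon>"
  shows "\<exists>T. \<forall>\<^sub>F n in sequentially. \<exists>\<C>. finite \<C>
    \<and> real (card \<C>) \<le> exp (real T * real n powr (real k - 1 / max_k_density k F) * ln (real n))
    \<and> (\<forall>C\<in>\<C>. real (card (embeddings_in F n C)) < \<epsilon> * real n ^ card (verts F))
    \<and> covers \<C> (\<lambda>I. I \<subseteq> k_sets k n \<and> embeddings_in F n I = {})"
proof -
  let ?m = "max_k_density k F" and ?v = "card (verts F)"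
  define l where "l = card (edges F)"
  have ne: "edges F \<noteq> {}" and k0: "0 < k" using max_k_density_pos_imp[OF F m] by auto
  have l0: "0 < l" using ne finite_edges[OF F] unfolding l_def by (simp add: card_gt_0_iff)
  have fin: "finite (verts F)" using F unfolding uniform_hypergraph_def by simp
  have kv: "k \<le> ?v" using card_spanned_ge[OF F order_refl ne] by simp
  then have v0: "0 < ?v" using k0 by simp
  obtain es where es: "bij_betw es {..<l} (edges F)"
    using ex_bij_betw_nat_finite[OF finite_edges[OF F]] unfolding l_def lessThan_atLeast0 by blast
  define c where "c = real (?v ^ ?v)"
  have c0: "0 < c" unfolding c_def using v0 by simp
  define x where "x = (\<lambda>(\<phi> :: 'a \<Rightarrow> nat) j. \<phi> ` es j)"
  obtain T p0 where p0: "0 < p0" and cont: "\<forall>(E :: ('a \<Rightarrow> nat) set) (x :: ('a \<Rightarrow> nat) \<Rightarrow> nat \<Rightarrow> nat set) V N q D p.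
    finite E \<longrightarrow> finite V \<longrightarrow> card V \<le> N \<longrightarrow> (\<forall>a\<in>E. \<forall>j<l. x a j \<in> V) \<longrightarrow> 0 < N \<longrightarrow>
    0 < p \<longrightarrow> p \<le> p0 \<longrightarrow> 0 < D \<longrightarrow> real q \<le> p * real N \<longrightarrow> p * real N \<le> 2 * real q \<longrightarrow>
    bounded_codeg E x {..<l} D p \<longrightarrow>
    (\<exists>\<C>. finite \<C> \<and> card \<C> \<le> (N + 1) ^ (T * q)
      \<and> (\<forall>C\<in>\<C>. C \<subseteq> V \<and> real (card {a\<in>E. \<forall>j<l. x a j \<in> C}) < \<epsilon> / c * D * real N)
      \<and> covers \<C> (\<lambda>I. I \<subseteq> V \<and> tuple_free E x {..<l} I))"
    using containers[OF l0 divide_pos_pos[OF \<epsilon> c0], where 'e = "'a \<Rightarrow> nat" and 'v = "nat set"]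
    by (elim exE conjE) (rule that; assumption)
  have "((\<lambda>n. real n powr (- 1 / ?m)) \<longlongrightarrow> 0) sequentially"
    using m by (intro tendsto_neg_powr filterlim_real_sequentially) auto
  then have "\<forall>\<^sub>F n in sequentially. real n powr (- 1 / ?m) < p0"
    using p0 by (rule order_tendstoD)
  then have "\<forall>\<^sub>F n in sequentially. \<exists>\<C>. finite \<C>
    \<and> real (card \<C>) \<le> exp (real (T * (k + 1)) * real n powr (real k - 1 / ?m) * ln (real n))
    \<and> (\<forall>C\<in>\<C>. real (card (embeddings_in F n C)) < \<epsilon> * real n ^ ?v)
    \<and> covers \<C> (\<lambda>I. I \<subseteq> k_sets k n \<and> embeddings_in F n I = {})"
    using eventually_ge_at_top[of 2]
  proof eventually_elim
    case (elim n)
    define p where "p = real n powr (- 1 / ?m)"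
    \<comment> \<open>The floor loses at most a factor 2 because \<open>p * n ^ k\<close> is at
      least 1.\<close>
    define q where "q = nat \<lfloor>p * real (n ^ k)\<rfloor>"
    \<comment> \<open>With \<open>N = n ^ k\<close> this makes \<open>D * N\<close> equal to
      \<open>c * n ^ v\<close>, which is why \<open>containers\<close> is used with
      \<open>\<epsilon> / c\<close>.\<close>
    define D where "D = c * real n powr (real ?v - real k)"
    have n0: "0 < real n" "1 \<le> real n" using elim by auto
    have pN: "p * real (n ^ k) = real n powr (real k - 1 / ?m)"
      unfolding p_def using n0 by (simp add: powr_realpow[symmetric] flip: powr_add)
    have "1 / real k \<le> ?m" by (rule max_k_density_ge[OF F ne])
    then have "0 \<le> real k - 1 / ?m" using m k0 by (simp add: field_simps)
    then have pN1: "1 \<le> p * real (n ^ k)" unfolding pN using n0 by (simp add: ge_one_powr_ge_zero)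
    have q: "real q \<le> p * real (n ^ k)" "p * real (n ^ k) \<le> 2 * real q"
    proof -
      have fl: "1 \<le> \<lfloor>p * real (n ^ k)\<rfloor>" using pN1 by (simp only: le_floor_iff of_int_1)
      then have "real q = of_int \<lfloor>p * real (n ^ k)\<rfloor>" unfolding q_def by simp
      then show "real q \<le> p * real (n ^ k)" "p * real (n ^ k) \<le> 2 * real q" using fl by linarith+
    qed
    have "\<exists>\<C>. finite \<C> \<and> card \<C> \<le> (n ^ k + 1) ^ (T * q)
      \<and> (\<forall>C\<in>\<C>. C \<subseteq> k_sets k n \<and> real (card {a\<in>embeddings F n. \<forall>j<l. x a j \<in> C}) < \<epsilon> / c * D * real (n ^ k))
      \<and> covers \<C> (\<lambda>I. I \<subseteq> k_sets k n \<and> tuple_free (embeddings F n) x {..<l} I)"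
    proof (rule cont[rule_format, where p = p])
      show "finite (embeddings F n)" using finite_embeddings[OF fin] .
      show "finite (k_sets k n)" by (rule finite_k_sets)
      show "card (k_sets k n) \<le> n ^ k" by (rule card_k_sets_le)
      show "x \<phi> j \<in> k_sets k n" if "\<phi> \<in> embeddings F n" "j < l" for \<phi> j
        using embedding_edge_in_k_sets[OF F that(1)] es that(2) unfolding x_def bij_betw_def by blast
      show "0 < n ^ k" using elim by simp
      show "0 < p" "p \<le> p0" using elim unfolding p_def by auto
      show "0 < D" unfolding D_def using c0 n0 by simp
      show "real q \<le> p * real (n ^ k)" "p * real (n ^ k) \<le> 2 * real q" using q by auto
      show "bounded_codeg (embeddings F n) x {..<l} D p"
        unfolding x_def D_def p_def c_def l_def
        by (rule bounded_codeg_embeddings[OF F m]) (use elim es l_def in auto)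
    qed
    then obtain \<C> where \<C>: "finite \<C>" "card \<C> \<le> (n ^ k + 1) ^ (T * q)"
      "\<forall>C\<in>\<C>. C \<subseteq> k_sets k n \<and> real (card {a\<in>embeddings F n. \<forall>j<l. x a j \<in> C}) < \<epsilon> / c * D * real (n ^ k)"
      "covers \<C> (\<lambda>I. I \<subseteq> k_sets k n \<and> tuple_free (embeddings F n) x {..<l} I)"
      by (elim exE conjE) (rule that; assumption)
    have in_eq: "{a\<in>embeddings F n. \<forall>j<l. x a j \<in> C} = embeddings_in F n C" for C
    proof -
      have "edges F = es ` {..<l}" using es unfolding bij_betw_def by simp
      then show ?thesis unfolding embeddings_in_def x_def by auto
    qed
    have DN: "\<epsilon> / c * D * real (n ^ k) = \<epsilon> * real n ^ ?v"
    proof -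
      have "real n powr (real ?v - real k) * real n ^ k = real n ^ ?v"
        using n0 by (simp add: powr_realpow[symmetric] flip: powr_add)
      then show ?thesis unfolding D_def using c0 by simp
    qed
    show ?case
    proof (intro exI[of _ \<C>] conjI)
      show "finite \<C>" by (rule \<C>(1))
      show "\<forall>C\<in>\<C>. real (card (embeddings_in F n C)) < \<epsilon> * real n ^ ?v"
        using \<C>(3) unfolding in_eq DN by blast
      show "covers \<C> (\<lambda>I. I \<subseteq> k_sets k n \<and> embeddings_in F n I = {})"
      proof -
        have "tuple_free (embeddings F n) x {..<l} I \<longleftrightarrow> embeddings_in F n I = {}" for I
          unfolding in_eq[symmetric] tuple_free_def by auto
        then show ?thesis using \<C>(4) by simp
      qed
      have "n ^ k + 1 \<le> n ^ (k + 1)"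
      proof -
        have "1 \<le> n ^ k" using elim by simp
        then have "n ^ k + 1 \<le> 2 * n ^ k" by simp
        also have "\<dots> \<le> n * n ^ k" using elim by (intro mult_right_mono) auto
        finally show ?thesis by simp
      qed
      then have card_le: "card \<C> \<le> (n ^ (k + 1)) ^ (T * q)"
        using \<C>(2) power_mono[of "n ^ k + 1" "n ^ (k + 1)" "T * q"] by linarith
      have "real (card \<C>) \<le> real n ^ (T * (k + 1) * q)"
      proof -
        have "(n ^ (k + 1)) ^ (T * q) = n ^ (T * (k + 1) * q)" by (simp only: power_mult[symmetric] mult_ac)
        then show ?thesis using card_le by (simp only: of_nat_power[symmetric] of_nat_le_iff)
      qed
      also have "\<dots> = exp (real (T * (k + 1)) * real q * ln (real n))"
        using n0 by (simp add: powr_realpow[symmetric] powr_def)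
      also have "\<dots> \<le> exp (real (T * (k + 1)) * real n powr (real k - 1 / ?m) * ln (real n))"
        using q(1) n0 unfolding pN by (simp add: mult_right_mono mult_left_mono)
      finally show "real (card \<C>) \<le> exp (real (T * (k + 1)) * real n powr (real k - 1 / ?m) * ln (real n))" .
    qed
  qed
  then show ?thesis by blast
qed

section \<open>The probability of containing no copy\<close>

text \<open>Sort \<open>\<psi>\<close> by the set \<open>J\<close> of edges that it maps to edges of
  the copy given by \<open>\<phi>\<close>. Then \<open>\<psi>\<close> sends the span of
  \<open>J\<close> into the image of \<open>\<phi>\<close>, and the two copies have
  \<open>2 * l - card J\<close> edges together, so \<open>dense\<close> for \<open>J\<close> saves a
  factor \<open>L\<close>. Different embeddings with the same image are included, with
  \<open>J = edges F\<close>.\<close>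

lemma sum_overlap_weight_embeddings_le:
  fixes F :: "'a hypergraph" and p L :: real
  assumes F: "uniform_hypergraph k F" and p: "0 < p" and L: "0 < L"
    and dense: "\<And>J. J \<subseteq> edges F \<Longrightarrow> J \<noteq> {} \<Longrightarrow> L \<le> real n ^ card (\<Union>J) * p ^ card J"
    and \<phi>: "\<phi> \<in> embeddings F n"
  defines "v \<equiv> card (verts F)" and "l \<equiv> card (edges F)"
  shows "(\<Sum>\<psi>\<in>embeddings F n. overlap_weight p (\<lambda>\<phi>. (\<lambda>e. \<phi> ` e) ` edges F) \<phi> \<psi>)
    \<le> 2 ^ l * (real (v ^ v) * (real n ^ v * p ^ (2 * l) / L))"
proof -
  define U where "U \<phi> = (\<lambda>e. \<phi> ` e) ` edges F" for \<phi> :: "'a \<Rightarrow> nat"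
  let ?Js = "{J. J \<subseteq> edges F \<and> J \<noteq> {}}"
  \<comment> \<open>Larger than the class of \<open>J\<close>, since only the location of the span
    is recorded; the sum over \<open>J\<close> may count an embedding repeatedly.\<close>
  define S where "S J = {\<psi> \<in> embeddings F n. \<psi> ` (\<Union>J) \<subseteq> \<phi> ` verts F}" for J
  have fin: "finite (verts F)" and sub: "\<And>e. e \<in> edges F \<Longrightarrow> e \<subseteq> verts F"
    using F unfolding uniform_hypergraph_def by auto
  have finE: "finite (edges F)" by (rule finite_edges[OF F])
  have finJs: "finite ?Js" using finE by simp
  have injU: "inj_on (\<lambda>e. \<psi> ` e) (edges F)" if "\<psi> \<in> embeddings F n" for \<psi>
  proof (rule inj_onI)
    fix d e assume "d \<in> edges F" "e \<in> edges F" "\<psi> ` d = \<psi> ` e"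
    then show "d = e" using that sub inj_on_image_eq_iff[of \<psi> "verts F" d e] unfolding embeddings_def by auto
  qed
  have cU: "card (U \<psi>) = l" if "\<psi> \<in> embeddings F n" for \<psi>
    unfolding U_def l_def using injU[OF that] by (rule card_image)
  have pw: "overlap_weight p U \<phi> \<psi> \<le> (\<Sum>J\<in>?Js. if \<psi> \<in> S J then p ^ (2 * l - card J) else 0)"
    if \<psi>: "\<psi> \<in> embeddings F n" for \<psi>
  proof (cases "U \<phi> \<inter> U \<psi> = {}")
    case True
    then show ?thesis using p by (simp add: overlap_weight_def sum_nonneg)
  next
    case False
    define J where "J = {e \<in> edges F. \<psi> ` e \<in> U \<phi>}"
    have UJ: "U \<phi> \<inter> U \<psi> = (\<lambda>e. \<psi> ` e) ` J" unfolding U_def J_def by blast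
    have "card (U \<phi> \<inter> U \<psi>) = card J"
      unfolding UJ by (rule card_image, rule inj_on_subset[OF injU[OF \<psi>]]) (auto simp: J_def)
    moreover have "card (U \<phi>) + card (U \<psi>) = card (U \<phi> \<union> U \<psi>) + card (U \<phi> \<inter> U \<psi>)"
      by (rule card_Un_Int) (use finE in \<open>auto simp: U_def\<close>)
    ultimately have cU2: "card (U \<phi> \<union> U \<psi>) = 2 * l - card J" using cU[OF \<phi>] cU[OF \<psi>] by simp
    have J: "J \<in> ?Js" using False UJ unfolding J_def by auto
    have "\<psi> \<in> S J"
      unfolding S_def
    proof (intro CollectI conjI \<psi> subsetI)
      fix y assume "y \<in> \<psi> ` \<Union>J"
      then obtain e where "e \<in> J" "y \<in> \<psi> ` e" by blast
      then obtain e' where "e' \<in> edges F" "\<psi> ` e = \<phi> ` e'" unfolding J_def U_def by blast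
      then show "y \<in> \<phi> ` verts F" using \<open>y \<in> \<psi> ` e\<close> sub by blast
    qed
    then have "overlap_weight p U \<phi> \<psi> = (if \<psi> \<in> S J then p ^ (2 * l - card J) else 0)"
      using False cU2 by (simp add: overlap_weight_def)
    also have "\<dots> \<le> (\<Sum>J\<in>?Js. if \<psi> \<in> S J then p ^ (2 * l - card J) else 0)"
      using finJs J p
      by (intro member_le_sum[of J ?Js "\<lambda>J. if \<psi> \<in> S J then p ^ (2 * l - card J) else 0"]) auto
    finally show ?thesis .
  qed
  have SJ: "real (card (S J)) * p ^ (2 * l - card J) \<le> real (v ^ v) * (real n ^ v * p ^ (2 * l) / L)"
    if J: "J \<in> ?Js" for J
  proof -
    let ?w = "card (\<Union>J)"
    have wv: "?w \<le> v" using card_spanned_ge[OF F] J unfolding v_def by auto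
    have Jl: "card J \<le> l" unfolding l_def using J finE by (intro card_mono) auto
    have "card (S J) \<le> card (\<phi> ` verts F) ^ ?w * n ^ (v - ?w)"
      unfolding S_def v_def using J sub fin by (intro card_embeddings_into_le) auto
    also have "\<dots> \<le> v ^ v * n ^ (v - ?w)"
    proof (rule mult_right_mono)
      have "card (\<phi> ` verts F) ^ ?w \<le> v ^ ?w"
        unfolding v_def using card_image_le[OF fin] by (rule power_mono) simp
      also have "\<dots> \<le> v ^ v"
      proof (cases "v = 0")
        case True then show ?thesis using wv by simp
      next
        case False then show ?thesis using wv by (intro power_increasing) auto
      qed
      finally show "card (\<phi> ` verts F) ^ ?w \<le> v ^ v" .
    qed simp
    finally have "real (card (S J)) \<le> real (v ^ v) * real n ^ (v - ?w)"
      by (simp flip: of_nat_power of_nat_mult)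
    then have "real (card (S J)) * p ^ (2 * l - card J)
        \<le> real (v ^ v) * (real n ^ (v - ?w) * p ^ (2 * l - card J))"
      using mult_right_mono[of _ _ "p ^ (2 * l - card J)"] p by (simp add: mult.assoc)
    also have "\<dots> \<le> real (v ^ v) * (real n ^ v * p ^ (2 * l) / L)"
    proof (rule mult_left_mono)
      have "real n ^ (v - ?w) * p ^ (2 * l - card J) * L
          \<le> real n ^ (v - ?w) * p ^ (2 * l - card J) * (real n ^ ?w * p ^ card J)"
        using dense J p by (intro mult_left_mono) auto
      also have "\<dots> = (real n ^ (v - ?w) * real n ^ ?w) * (p ^ (2 * l - card J) * p ^ card J)" by (simp add: mult_ac)
      also have "\<dots> = real n ^ v * p ^ (2 * l)" using wv Jl by (simp flip: power_add)
      finally show "real n ^ (v - ?w) * p ^ (2 * l - card J) \<le> real n ^ v * p ^ (2 * l) / L"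
        using L by (simp add: pos_le_divide_eq)
    qed simp
    finally show ?thesis .
  qed
  have "(\<Sum>\<psi>\<in>embeddings F n. overlap_weight p U \<phi> \<psi>)
      \<le> (\<Sum>\<psi>\<in>embeddings F n. \<Sum>J\<in>?Js. if \<psi> \<in> S J then p ^ (2 * l - card J) else 0)"
    by (rule sum_mono) (rule pw)
  also have "\<dots> = (\<Sum>J\<in>?Js. \<Sum>\<psi>\<in>embeddings F n. if \<psi> \<in> S J then p ^ (2 * l - card J) else 0)"
    by (rule sum.swap)
  also have "\<dots> = (\<Sum>J\<in>?Js. real (card (S J)) * p ^ (2 * l - card J))"
  proof (rule sum.cong[OF refl])
    fix J
    have "embeddings F n \<inter> {\<psi>. \<psi> \<in> S J} = S J" unfolding S_def by blast
    then show "(\<Sum>\<psi>\<in>embeddings F n. if \<psi> \<in> S J then p ^ (2 * l - card J) else 0)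
        = real (card (S J)) * p ^ (2 * l - card J)"
      using finite_embeddings[OF fin, of n] by (simp add: sum.If_cases)
  qed
  also have "\<dots> \<le> (\<Sum>J\<in>?Js. real (v ^ v) * (real n ^ v * p ^ (2 * l) / L))"
    by (rule sum_mono) (rule SJ)
  also have "\<dots> = real (card ?Js) * (real (v ^ v) * (real n ^ v * p ^ (2 * l) / L))" by simp
  also have "\<dots> \<le> 2 ^ l * (real (v ^ v) * (real n ^ v * p ^ (2 * l) / L))"
  proof (rule mult_right_mono)
    have "card ?Js \<le> card (Pow (edges F))" by (rule card_mono) (use finE in auto)
    then show "real (card ?Js) \<le> 2 ^ l" using finE unfolding l_def by (simp add: card_Pow)
  qed (use p L in simp)
  finally show ?thesis unfolding U_def .
qed

text \<open>With \<open>y\<close> the order of the expected number of embeddings, the mean is at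
  least \<open>\<delta> * y\<close> and the overlaps are at most \<open>b * y ^ 2 / L\<close>.
  Janson's inequality then gives an exponent of order \<open>L\<close>, a lower bound on the
  expected counts of all nonempty subgraphs.\<close>

theorem prob_no_embedding_le:
  fixes F :: "'a hypergraph" and \<delta> :: real
  assumes F: "uniform_hypergraph k F" and ne: "edges F \<noteq> {}" and \<delta>: "0 < \<delta>" "\<delta> \<le> 1"
  shows "\<exists>c>0. \<forall>n K. \<forall>p L :: real. 1 \<le> n \<longrightarrow> 0 < p \<longrightarrow> p \<le> 1 \<longrightarrow> 0 < L \<longrightarrow>
    \<delta> * real n ^ card (verts F) \<le> real (card (embeddings_in F n K)) \<longrightarrow>
    (\<forall>J. J \<subseteq> edges F \<and> J \<noteq> {} \<longrightarrow> L \<le> real n ^ card (\<Union>J) * p ^ card J) \<longrightarrow>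
    measure_pmf.prob (Pi_pmf (k_sets k n) False (\<lambda>_. bernoulli_pmf p))
      {X. \<forall>\<phi>\<in>embeddings_in F n K. \<exists>e\<in>edges F. \<not> X (\<phi> ` e)} \<le> exp (- (c * L))"
proof -
  let ?v = "card (verts F)" and ?l = "card (edges F)"
  define b where "b = 2 ^ ?l * real (?v ^ ?v)"
  have fin: "finite (verts F)" using F unfolding uniform_hypergraph_def by simp
  have b1: "1 \<le> b"
  proof -
    have "1 \<le> real (?v ^ ?v)" by (cases "?v = 0") auto
    then show ?thesis unfolding b_def using mult_mono[of 1 "2 ^ ?l" 1 "real (?v ^ ?v)"] by simp
  qed
  have main: "measure_pmf.prob (Pi_pmf (k_sets k n) False (\<lambda>_. bernoulli_pmf p))
      {X. \<forall>\<phi>\<in>embeddings_in F n K. \<exists>e\<in>edges F. \<not> X (\<phi> ` e)} \<le> exp (- (\<delta>\<^sup>2 / (4 * b) * L))"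
    if n: "1 \<le> n" and p: "0 < p" "p \<le> 1" and L: "0 < L"
      and big: "\<delta> * real n ^ ?v \<le> real (card (embeddings_in F n K))"
      and dense: "\<forall>J. J \<subseteq> edges F \<and> J \<noteq> {} \<longrightarrow> L \<le> real n ^ card (\<Union>J) * p ^ card J"
    for n K and p L :: real
  proof -
    define U where "U \<phi> = (\<lambda>e. \<phi> ` e) ` edges F" for \<phi> :: "'a \<Rightarrow> nat"
    define \<Phi> where "\<Phi> = embeddings_in F n K"
    define y where "y = real n ^ ?v * p ^ ?l"
    \<comment> \<open>The maximiser of \<open>s * \<delta> * y - s ^ 2 * b * y ^ 2 / L\<close>. It
      is at most 1 since \<open>L \<le> y\<close>, \<open>\<delta> \<le> 1\<close> and
      \<open>b \<ge> 1\<close>.\<close>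
    define s where "s = \<delta> * L / (2 * b * y)"
    have y0: "0 < y" unfolding y_def using n p by simp
    have \<Phi>sub: "\<Phi> \<subseteq> embeddings F n" unfolding \<Phi>_def by (rule embeddings_in_subset)
    have fin\<Phi>: "finite \<Phi>" using \<Phi>sub finite_embeddings[OF fin] finite_subset by blast
    have w0: "0 \<le> overlap_weight p U \<phi> \<psi>" for \<phi> \<psi> using p by (simp add: overlap_weight_def)
    have Ly: "L \<le> y"
    proof -
      have "L \<le> real n ^ card (\<Union>(edges F)) * p ^ ?l" using dense ne by blast
      also have "\<dots> \<le> y" unfolding y_def
        using n p card_spanned_ge(2)[OF F order_refl ne] by (intro mult_right_mono power_increasing) auto
      finally show ?thesis .
    qed
    have s: "0 \<le> s" "s \<le> 1"
    proof -
      show "0 \<le> s" unfolding s_def using \<delta> L b1 y0 by simp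
      have "\<delta> * L \<le> 1 * y" using \<delta> L Ly by (intro mult_mono) auto
      also have "\<dots> \<le> (2 * b) * y" using b1 y0 by (intro mult_right_mono) auto
      finally show "s \<le> 1" unfolding s_def using b1 y0 by simp
    qed
    have mu: "\<delta> * y \<le> (\<Sum>\<phi>\<in>\<Phi>. p ^ card (U \<phi>))"
    proof -
      have "\<delta> * y = \<delta> * real n ^ ?v * p ^ ?l" unfolding y_def by simp
      also have "\<dots> \<le> real (card \<Phi>) * p ^ ?l" unfolding \<Phi>_def using big p by (intro mult_right_mono) auto
      also have "\<dots> = (\<Sum>\<phi>\<in>\<Phi>. p ^ ?l)" by simp
      also have "\<dots> \<le> (\<Sum>\<phi>\<in>\<Phi>. p ^ card (U \<phi>))"
        unfolding U_def using p card_image_le[OF finite_edges[OF F]] by (intro sum_mono power_decreasing) auto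
      finally show ?thesis .
    qed
    have Delta: "off_diagonal_sum (overlap_weight p U) \<Phi> \<le> b * y\<^sup>2 / L"
    proof -
      have "off_diagonal_sum (overlap_weight p U) \<Phi> \<le> (\<Sum>\<phi>\<in>\<Phi>. \<Sum>\<psi>\<in>embeddings F n. overlap_weight p U \<phi> \<psi>)"
        unfolding off_diagonal_sum_def using \<Phi>sub w0 finite_embeddings[OF fin]
        by (intro sum_mono sum_mono2) auto
      also have "\<dots> \<le> (\<Sum>\<phi>\<in>\<Phi>. 2 ^ ?l * (real (?v ^ ?v) * (real n ^ ?v * p ^ (2 * ?l) / L)))"
        unfolding U_def
        by (intro sum_mono sum_overlap_weight_embeddings_le[OF F p(1) L]) (use dense \<Phi>sub in auto)
      also have "\<dots> = real (card \<Phi>) * (b * (real n ^ ?v * p ^ (2 * ?l) / L))" unfolding b_def by simp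
      also have "\<dots> \<le> real n ^ ?v * (b * (real n ^ ?v * p ^ (2 * ?l) / L))"
      proof (rule mult_right_mono)
        have "card \<Phi> \<le> n ^ ?v"
          using card_mono[OF finite_embeddings[OF fin] \<Phi>sub] card_embeddings_le[OF fin, of n] by linarith
        then show "real (card \<Phi>) \<le> real n ^ ?v" by (simp flip: of_nat_power)
      qed (use b1 p L in simp)
      also have "\<dots> = b * y\<^sup>2 / L" unfolding y_def by (simp add: power2_eq_square power_mult mult_ac power_mult_distrib)
      finally show ?thesis .
    qed
    have "{X. \<forall>\<phi>\<in>embeddings_in F n K. \<exists>e\<in>edges F. \<not> X (\<phi> ` e)} = avoiding U \<Phi>"
      unfolding avoiding_def U_def \<Phi>_def by auto
    then have "measure_pmf.prob (Pi_pmf (k_sets k n) False (\<lambda>_. bernoulli_pmf p))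
      {X. \<forall>\<phi>\<in>embeddings_in F n K. \<exists>e\<in>edges F. \<not> X (\<phi> ` e)}
      = measure_pmf.prob (Pi_pmf (k_sets k n) False (\<lambda>_. bernoulli_pmf p)) (avoiding U \<Phi>)" by simp
    also have "\<dots> \<le> exp (- (s * (\<Sum>a\<in>\<Phi>. p ^ card (U a)) - s\<^sup>2 * off_diagonal_sum (overlap_weight p U) \<Phi>))"
    proof (rule janson_inequality[OF finite_k_sets fin\<Phi>])
      show "U \<phi> \<subseteq> k_sets k n" if "\<phi> \<in> \<Phi>" for \<phi>
        using embedding_edge_in_k_sets[OF F] that \<Phi>sub unfolding U_def by blast
    qed (use p s in auto)
    also have "\<dots> \<le> exp (- (\<delta>\<^sup>2 / (4 * b) * L))"
    proof -
      have "s * (\<delta> * y) \<le> s * (\<Sum>a\<in>\<Phi>. p ^ card (U a))" using mu s by (intro mult_left_mono)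
      moreover have "s\<^sup>2 * off_diagonal_sum (overlap_weight p U) \<Phi> \<le> s\<^sup>2 * (b * y\<^sup>2 / L)"
        using Delta by (intro mult_left_mono) auto
      moreover have "s * (\<delta> * y) - s\<^sup>2 * (b * y\<^sup>2 / L) = \<delta>\<^sup>2 / (4 * b) * L"
        unfolding s_def using y0 b1 L by (simp add: field_simps power2_eq_square)
      ultimately show ?thesis by simp
    qed
    finally show ?thesis .
  qed
  have c0: "0 < \<delta>\<^sup>2 / (4 * b)" using \<delta> b1 by simp
  show ?thesis
    by (rule exI[of _ "\<delta>\<^sup>2 / (4 * b)"], rule conjI, rule c0, intro allI impI, rule main; assumption)
qed

section \<open>The random Ramsey theorem\<close>

lemma monochromatic_copy_of_embedding:
  assumes F: "uniform_hypergraph k F" and \<phi>: "\<phi> \<in> embeddings F n"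
    and "\<And>e. e \<in> edges F \<Longrightarrow> X (\<phi> ` e) \<and> col (\<phi> ` e) = i"
  shows "\<exists>H. subhypergraph H (Hypergraph {1..n} {e \<in> k_sets k n. X e}) \<and> isomorphic F H
    \<and> (\<forall>e\<in>edges H. col e = i)"
proof (intro exI conjI)
  let ?H = "Hypergraph (\<phi> ` verts F) ((\<lambda>e. \<phi> ` e) ` edges F)"
  have \<phi>V: "\<phi> ` verts F \<subseteq> {1..n}" "inj_on \<phi> (verts F)" using \<phi> unfolding embeddings_def by auto
  show "subhypergraph ?H (Hypergraph {1..n} {e \<in> k_sets k n. X e})"
  proof -
    have "\<phi> ` e \<subseteq> \<phi> ` verts F" if "e \<in> edges F" for e
      using F that unfolding uniform_hypergraph_def by (simp add: image_mono)
    then show ?thesis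
      using \<phi>V assms(3) embedding_edge_in_k_sets[OF F \<phi>] unfolding subhypergraph_def by auto
  qed
  show "isomorphic F ?H"
    unfolding isomorphic_def using \<phi>V(2) by (intro exI[of _ \<phi>]) (simp add: bij_betw_def)
  show "\<forall>e\<in>edges ?H. col e = i" using assms(3) by auto
qed

text \<open>Fix a bad colouring and cover its classes \<open>2..r\<close> by containers. A present
  \<open>k\<close>-set outside all of them must have colour 1, so a fully present copy of
  \<open>F 1\<close> there would be monochromatic.\<close>

lemma not_arrows_cover:
  fixes F :: "nat \<Rightarrow> 'a hypergraph"
  assumes r: "1 \<le> r" and unif: "\<And>i. i \<in> {1..r} \<Longrightarrow> uniform_hypergraph k (F i)"
    and cov: "\<And>i. i \<in> {2..r} \<Longrightarrow> covers (\<C> i) (\<lambda>I. I \<subseteq> k_sets k n \<and> embeddings_in (F i) n I = {})"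
    and X: "\<not> arrows (Hypergraph {1..n} {e \<in> k_sets k n. X e}) r F"
  shows "\<exists>C \<in> PiE {2..r} \<C>. \<forall>\<phi>\<in>embeddings_in (F 1) n (k_sets k n - (\<Union>i\<in>{2..r}. C i)).
    \<exists>e\<in>edges (F 1). \<not> X (\<phi> ` e)"
proof -
  obtain col where col: "\<And>e. e \<in> k_sets k n \<Longrightarrow> X e \<Longrightarrow> col e \<in> {1..r}"
    and no: "\<And>i H. i \<in> {1..r} \<Longrightarrow> subhypergraph H (Hypergraph {1..n} {e \<in> k_sets k n. X e})
      \<Longrightarrow> isomorphic (F i) H \<Longrightarrow> \<not> (\<forall>e\<in>edges H. col e = i)"
    using X unfolding arrows_def hypergraph.sel by blast
  define I where "I i = {e \<in> k_sets k n. X e \<and> col e = i}" for i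
  have empty: "embeddings_in (F i) n (I i) = {}" if i: "i \<in> {1..r}" for i
  proof (rule ccontr)
    assume "embeddings_in (F i) n (I i) \<noteq> {}"
    then obtain \<phi> where \<phi>: "\<phi> \<in> embeddings (F i) n" "\<And>e. e \<in> edges (F i) \<Longrightarrow> \<phi> ` e \<in> I i"
      unfolding embeddings_in_def by auto
    then show False
      using monochromatic_copy_of_embedding[OF unif[OF i] \<phi>(1), of X col i] no[OF i] unfolding I_def by blast
  qed
  have "\<exists>D. D \<in> \<C> i \<and> I i \<subseteq> D" if i: "i \<in> {2..r}" for i
  proof -
    have "I i \<subseteq> k_sets k n" unfolding I_def by blast
    moreover have "embeddings_in (F i) n (I i) = {}" using empty i by simp
    ultimately show ?thesis using cov[OF i] unfolding covers_def by blast
  qed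
  then have "\<forall>i\<in>{2..r}. \<exists>D. D \<in> \<C> i \<and> I i \<subseteq> D" by (rule ballI)
  from bchoice[OF this] obtain C0 where C0: "\<And>i. i \<in> {2..r} \<Longrightarrow> C0 i \<in> \<C> i \<and> I i \<subseteq> C0 i" by blast
  define C where "C = restrict C0 {2..r}"
  have C: "C i \<in> \<C> i" "I i \<subseteq> C i" if "i \<in> {2..r}" for i using C0[OF that] that unfolding C_def by auto
  show ?thesis
  proof (intro bexI[of _ C] ballI)
    show "C \<in> PiE {2..r} \<C>" using C0 unfolding C_def by auto
    fix \<phi> assume \<phi>: "\<phi> \<in> embeddings_in (F 1) n (k_sets k n - (\<Union>i\<in>{2..r}. C i))"
    show "\<exists>e\<in>edges (F 1). \<not> X (\<phi> ` e)"
    proof (rule ccontr)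
      assume "\<not> ?thesis"
      then have Xe: "X (\<phi> ` e)" if "e \<in> edges (F 1)" for e using that by blast
      have "\<phi> ` e \<in> I 1" if e: "e \<in> edges (F 1)" for e
      proof -
        have K: "\<phi> ` e \<in> k_sets k n" "\<And>i. i \<in> {2..r} \<Longrightarrow> \<phi> ` e \<notin> C i"
          using \<phi> e unfolding embeddings_in_def by auto
        have "col (\<phi> ` e) \<in> {1..r}" using col K(1) Xe[OF e] by blast
        moreover have "col (\<phi> ` e) \<notin> {2..r}"
        proof
          assume "col (\<phi> ` e) \<in> {2..r}"
          moreover have "\<phi> ` e \<in> I (col (\<phi> ` e))" using K(1) Xe[OF e] unfolding I_def by simp
          ultimately show False using C(2) K(2) by blast
        qed
        ultimately have "col (\<phi> ` e) = 1" by auto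
        then show ?thesis using K(1) Xe[OF e] unfolding I_def by simp
      qed
      then have "\<phi> \<in> embeddings_in (F 1) n (I 1)" using \<phi> unfolding embeddings_in_def by simp
      then show False using empty[of 1] r by simp
    qed
  qed
qed

text \<open>The asymmetric density makes the power of \<open>n\<close> at least
  \<open>k - 1 / m\<close> for every \<open>J\<close>. From \<open>n \<ge> 3\<close> and
  \<open>C \<ge> 1\<close> the factor \<open>C * ln n\<close> is at least 1, so it survives being
  raised to the power \<open>card J\<close>.\<close>

lemma threshold_expected_count_ge:
  fixes F1 F2 :: "'a hypergraph"
  assumes F: "uniform_hypergraph k F1" and m: "0 < max_k_density k F2"
    and J: "J \<subseteq> edges F1" "J \<noteq> {}" and n: "3 \<le> n" and C: "1 \<le> C"
    and p: "C * real n powr (- 1 / asym_k_density k F1 F2) * ln (real n) \<le> p"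
  shows "C * (real n powr (real k - 1 / max_k_density k F2) * ln (real n)) \<le> real n ^ card (\<Union>J) * p ^ card J"
proof -
  let ?a = "asym_k_density k F1 F2" and ?w = "card (\<Union>J)"
  have ln1: "1 \<le> ln (real n)"
  proof -
    have "exp 1 \<le> real n" using exp_le n by (meson numeral_le_real_of_nat_iff order_trans)
    then show ?thesis using n by (simp add: ln_ge_iff)
  qed
  have C1: "1 \<le> C * ln (real n)" using mult_mono[of 1 C 1 "ln (real n)"] C ln1 by simp
  have J1: "1 \<le> card J"
    using J finite_subset[OF J(1) finite_edges[OF F]] by (simp add: Suc_leI card_gt_0_iff)
  have dens: "real (card J) / ?a \<le> real ?w - real k + 1 / max_k_density k F2"
    by (rule asym_k_density_spanned(2)[OF F m J])
  have n0: "0 < real n" "1 \<le> real n" using n by auto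
  have "C * (real n powr (real k - 1 / max_k_density k F2) * ln (real n))
      = C * ln (real n) * real n powr (real k - 1 / max_k_density k F2)" by simp
  also have "\<dots> \<le> (C * ln (real n)) ^ card J * real n powr (real ?w - real (card J) / ?a)"
  proof (rule mult_mono)
    show "C * ln (real n) \<le> (C * ln (real n)) ^ card J"
      using power_increasing[OF J1 C1] by simp
    show "real n powr (real k - 1 / max_k_density k F2) \<le> real n powr (real ?w - real (card J) / ?a)"
      using dens n0 by (intro powr_mono) auto
  qed (use C1 in auto)
  also have "\<dots> = real n ^ ?w * (C * real n powr (- 1 / ?a) * ln (real n)) ^ card J"
  proof -
    have "real n powr (real ?w - real (card J) / ?a) = real n ^ ?w * (real n powr (- 1 / ?a)) ^ card J"
      using n0 by (simp add: powr_realpow[symmetric] powr_powr flip: powr_add)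
    then show ?thesis by (simp add: power_mult_distrib mult_ac)
  qed
  also have "\<dots> \<le> real n ^ ?w * p ^ card J"
    using p C ln1 by (intro mult_left_mono power_mono) auto
  finally show ?thesis .
qed

theorem theorem6p1:
  fixes k r :: nat and F :: "nat \<Rightarrow> 'a hypergraph"
  assumes "r \<ge> 2"
    and "\<And>i. i \<in> {1..r} \<Longrightarrow> uniform_hypergraph k (F i)"
    and "\<And>i. i \<in> {1..<r} \<Longrightarrow> max_k_density k (F i) \<ge> max_k_density k (F (Suc i))"
    and "max_k_density k (F r) > 0"
  shows "\<exists>C>0. \<forall>p :: nat \<Rightarrow> real.
           (\<forall>n. 0 \<le> p n \<and> p n \<le> 1) \<longrightarrow>
           (\<forall>\<^sub>F n in sequentially.
              p n \<ge> C * real n powr (- 1 / asym_k_density k (F 1) (F 2)) * ln (real n)) \<longrightarrow>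
           (\<lambda>n. measure_pmf.prob (binomial_hypergraph k n (p n)) {G. arrows G r F})
             \<longlonglongrightarrow> 1"
proof -
  let ?m = "\<lambda>i. max_k_density k (F i)"
  have chain: "?m j \<le> ?m i" if "i \<le> j" "1 \<le> i" "j \<le> r" for i j
    using that
  proof (induction j rule: dec_induct)
    case (step j)
    then show ?case using assms(3)[of j] by simp
  qed simp
  have pos: "0 < ?m i" if "i \<in> {1..r}" for i
    using chain[of i r] that assms(4) by auto
  define \<kappa> where "\<kappa> = real k - 1 / ?m 2"
  have F1: "uniform_hypergraph k (F 1)" and F2: "uniform_hypergraph k (F 2)" using assms(1,2) by auto
  have ne1: "edges (F 1) \<noteq> {}" and k0: "0 < k"
    using max_k_density_pos_imp[OF F1 pos] assms(1) by auto
  have m2: "0 < ?m 2" using pos assms(1) by simp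
  have "1 / real k \<le> ?m 2"
    using max_k_density_ge[OF F2] max_k_density_pos_imp[OF F2 m2] by simp
  then have \<kappa>0: "0 \<le> \<kappa>" unfolding \<kappa>_def using m2 k0 by (simp add: field_simps)
  have \<kappa>_ge: "real k - 1 / ?m i \<le> \<kappa>" if "i \<in> {2..r}" for i
    unfolding \<kappa>_def using chain[of 2 i] that pos[of i] by (simp add: frac_le)
  have "\<exists>\<delta>>0. \<exists>n0. \<forall>n\<ge>n0. \<forall>C. k_sets k n \<subseteq> (\<Union>i\<in>{1..r}. C i) \<longrightarrow>
    (\<exists>i\<in>{1..r}. \<delta> * real n ^ card (verts (F i)) \<le> real (card (embeddings_in (F i) n (C i))))"
    by (rule ramsey_supersaturation) (rule assms(2))
  then obtain \<delta>0 n0 where \<delta>0: "0 < \<delta>0" and super: "\<forall>n\<ge>n0. \<forall>C. k_sets k n \<subseteq> (\<Union>i\<in>{1..r}. C i) \<longrightarrow>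
    (\<exists>i\<in>{1..r}. \<delta>0 * real n ^ card (verts (F i)) \<le> real (card (embeddings_in (F i) n (C i))))"
    by (elim exE conjE) (rule that; assumption)
  \<comment> \<open>Capped at 1 for \<open>prob_no_embedding_le\<close>. The same
    \<open>\<delta>\<close> bounds the number of copies in a container.\<close>
  define \<delta> where "\<delta> = min \<delta>0 1"
  have \<delta>: "0 < \<delta>" "\<delta> \<le> 1" "\<delta> \<le> \<delta>0" unfolding \<delta>_def using \<delta>0 by auto
  obtain c where c: "0 < c" and janson: "\<forall>n K. \<forall>p L :: real. 1 \<le> n \<longrightarrow> 0 < p \<longrightarrow> p \<le> 1 \<longrightarrow> 0 < L \<longrightarrow>
    \<delta> * real n ^ card (verts (F 1)) \<le> real (card (embeddings_in (F 1) n K)) \<longrightarrow>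
    (\<forall>J. J \<subseteq> edges (F 1) \<and> J \<noteq> {} \<longrightarrow> L \<le> real n ^ card (\<Union>J) * p ^ card J) \<longrightarrow>
    measure_pmf.prob (Pi_pmf (k_sets k n) False (\<lambda>_. bernoulli_pmf p))
      {X. \<forall>\<phi>\<in>embeddings_in (F 1) n K. \<exists>e\<in>edges (F 1). \<not> X (\<phi> ` e)} \<le> exp (- (c * L))"
    using prob_no_embedding_le[OF F1 ne1 \<delta>(1,2)] by (elim exE conjE) (rule that; assumption)
  define container_family where "container_family i n T \<C> \<longleftrightarrow> finite \<C>
    \<and> real (card \<C>) \<le> exp (real T * real n powr (real k - 1 / ?m i) * ln (real n))
    \<and> (\<forall>C\<in>\<C>. real (card (embeddings_in (F i) n C)) < \<delta> * real n ^ card (verts (F i)))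
    \<and> covers \<C> (\<lambda>I. I \<subseteq> k_sets k n \<and> embeddings_in (F i) n I = {})" for i n T \<C>
  have "\<forall>i\<in>{2..r}. \<exists>T. \<forall>\<^sub>F n in sequentially. \<exists>\<C>. container_family i n T \<C>"
    unfolding container_family_def
    using hypergraph_containers[OF assms(2) pos \<delta>(1)] by auto
  from bchoice[OF this] obtain T where
    T: "\<And>i. i \<in> {2..r} \<Longrightarrow> \<forall>\<^sub>F n in sequentially. \<exists>\<C>. container_family i n (T i) \<C>" by blast
  define t where "t = (\<Sum>i\<in>{2..r}. real (T i))"
  \<comment> \<open>The containers cost \<open>t\<close> in the exponent, in units of
    \<open>n powr \<kappa> * ln n\<close>, and Janson gains \<open>c * C\<close>. The surplus 1
    leaves a failure probability of at most \<open>1 / n\<close>, as \<open>n powr \<kappa>\<close>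
    is at least 1.\<close>
  define C where "C = max 1 ((t + 1) / c)"
  have t0: "0 \<le> t" unfolding t_def by (simp add: sum_nonneg)
  have C1: "1 \<le> C" and cC: "t + 1 \<le> c * C"
  proof -
    show "1 \<le> C" unfolding C_def by simp
    have "(t + 1) / c \<le> C" unfolding C_def by simp
    then show "t + 1 \<le> c * C" using c by (simp add: pos_divide_le_eq mult.commute)
  qed
  have lim: "(\<lambda>n. measure_pmf.prob (binomial_hypergraph k n (p n)) {G. arrows G r F}) \<longlonglongrightarrow> 1"
    if p01: "\<forall>n. 0 \<le> p n \<and> p n \<le> 1"
      and pge: "\<forall>\<^sub>F n in sequentially. p n \<ge> C * real n powr (- 1 / asym_k_density k (F 1) (F 2)) * ln (real n)"
    for p :: "nat \<Rightarrow> real"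
  proof -
    have "\<forall>\<^sub>F n in sequentially. \<forall>i\<in>{2..r}. \<exists>\<C>. container_family i n (T i) \<C>"
      using T by (intro eventually_ball_finite) auto
    then have low: "\<forall>\<^sub>F n in sequentially.
        1 - 1 / real n \<le> measure_pmf.prob (binomial_hypergraph k n (p n)) {G. arrows G r F}"
      using pge eventually_ge_at_top[of 3] eventually_ge_at_top[of n0]
    proof eventually_elim
      case (elim n)
      from bchoice[OF elim(1)] obtain \<C> where \<C>: "\<And>i. i \<in> {2..r} \<Longrightarrow> container_family i n (T i) (\<C> i)" by blast
      define P where "P = measure_pmf.prob (Pi_pmf (k_sets k n) False (\<lambda>_. bernoulli_pmf (p n)))"
      define K where "K D = k_sets k n - (\<Union>i\<in>{2..r}. D i)" for D :: "nat \<Rightarrow> nat set set"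
      define bad where "bad D = {X. \<forall>\<phi>\<in>embeddings_in (F 1) n (K D). \<exists>e\<in>edges (F 1). \<not> X (\<phi> ` e)}" for D
      define L where "L = C * (real n powr \<kappa> * ln (real n))"
      have n0: "0 < real n" "1 \<le> real n" using elim by auto
      have lnn: "0 < ln (real n)" using elim by simp
      have pn: "0 < p n"
        by (rule less_le_trans[OF _ elim(2)]) (use C1 n0 lnn in simp)
      have L0: "0 < L" unfolding L_def using C1 n0 lnn by simp
      have finC: "finite (\<C> i)" if "i \<in> {2..r}" for i using \<C>[OF that] unfolding container_family_def by blast
      have finPi: "finite (PiE {2..r} \<C>)" using finC by (intro finite_PiE) auto
      have bad_le: "P (bad D) \<le> exp (- (c * L))" if D: "D \<in> PiE {2..r} \<C>" for D
        unfolding P_def bad_def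
      proof (rule janson[rule_format])
        \<comment> \<open>Supersaturation is applied to the containers with the leftover
          \<open>K D\<close> in place 1. The containers hold too few copies of their own
          \<open>F i\<close>, so the rich class must be \<open>K D\<close>.\<close>
        define D' where "D' i = (if i = 1 then K D else D i)" for i
        have "k_sets k n \<subseteq> (\<Union>i\<in>{1..r}. D' i)"
        proof
          fix e assume e: "e \<in> k_sets k n"
          show "e \<in> (\<Union>i\<in>{1..r}. D' i)"
          proof (cases "\<exists>i\<in>{2..r}. e \<in> D i")
            case True
            then obtain i where i: "i \<in> {2..r}" "e \<in> D i" by blast
            then have "i \<in> {1..r}" "e \<in> D' i" unfolding D'_def by auto
            then show ?thesis by blast
          next
            case False
            then have "1 \<in> {1..r}" "e \<in> D' 1" using e assms(1) unfolding D'_def K_def by auto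
            then show ?thesis by blast
          qed
        qed
        then obtain i where i: "i \<in> {1..r}"
          "\<delta>0 * real n ^ card (verts (F i)) \<le> real (card (embeddings_in (F i) n (D' i)))"
          using super elim by blast
        have big: "\<delta> * real n ^ card (verts (F i)) \<le> real (card (embeddings_in (F i) n (D' i)))"
          using mult_right_mono[OF \<delta>(3), of "real n ^ card (verts (F i))"] i(2) by simp
        have "i = 1"
        proof (rule ccontr)
          assume "i \<noteq> 1"
          then have i2: "i \<in> {2..r}" using i(1) by auto
          then have "D i \<in> \<C> i" using D by (rule PiE_mem[rotated])
          then have "real (card (embeddings_in (F i) n (D i))) < \<delta> * real n ^ card (verts (F i))"
            using \<C>[OF i2] unfolding container_family_def by blast
          then show False using big \<open>i \<noteq> 1\<close> unfolding D'_def by simp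
        qed
        then show "\<delta> * real n ^ card (verts (F 1)) \<le> real (card (embeddings_in (F 1) n (K D)))"
          using big unfolding D'_def by simp
        show "L \<le> real n ^ card (\<Union>J) * p n ^ card J" if "J \<subseteq> edges (F 1) \<and> J \<noteq> {}" for J
          unfolding L_def \<kappa>_def using that elim C1
          by (intro threshold_expected_count_ge[OF F1 m2]) auto
      qed (use elim pn p01 L0 in auto)
      have "P {X. \<not> arrows (Hypergraph {1..n} {e \<in> k_sets k n. X e}) r F} \<le> P (\<Union>D\<in>PiE {2..r} \<C>. bad D)"
        unfolding P_def
      proof (rule measure_pmf.finite_measure_mono)
        show "{X. \<not> arrows (Hypergraph {1..n} {e \<in> k_sets k n. X e}) r F} \<subseteq> (\<Union>D\<in>PiE {2..r} \<C>. bad D)"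
        proof
          fix X assume "X \<in> {X. \<not> arrows (Hypergraph {1..n} {e \<in> k_sets k n. X e}) r F}"
          then have X: "\<not> arrows (Hypergraph {1..n} {e \<in> k_sets k n. X e}) r F" by simp
          have "\<exists>D \<in> PiE {2..r} \<C>. \<forall>\<phi>\<in>embeddings_in (F 1) n (k_sets k n - (\<Union>i\<in>{2..r}. D i)).
            \<exists>e\<in>edges (F 1). \<not> X (\<phi> ` e)"
          proof (rule not_arrows_cover[OF _ assms(2) _ X])
            show "covers (\<C> i) (\<lambda>I. I \<subseteq> k_sets k n \<and> embeddings_in (F i) n I = {})" if "i \<in> {2..r}" for i
              using \<C>[OF that] unfolding container_family_def by blast
          qed (use assms(1) in auto)
          then show "X \<in> (\<Union>D\<in>PiE {2..r} \<C>. bad D)" unfolding bad_def K_def by blast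
        qed
      qed simp
      also have "\<dots> \<le> (\<Sum>D\<in>PiE {2..r} \<C>. P (bad D))"
        unfolding P_def using finPi by (intro measure_pmf.finite_measure_subadditive_finite) auto
      also have "\<dots> \<le> (\<Sum>D\<in>PiE {2..r} \<C>. exp (- (c * L)))" by (rule sum_mono) (rule bad_le)
      also have "\<dots> = (\<Prod>i\<in>{2..r}. real (card (\<C> i))) * exp (- (c * L))"
        by (simp add: card_PiE)
      also have "\<dots> \<le> exp (t * real n powr \<kappa> * ln (real n)) * exp (- (c * L))"
      proof (rule mult_right_mono)
        have "(\<Prod>i\<in>{2..r}. real (card (\<C> i))) \<le> (\<Prod>i\<in>{2..r}. exp (real (T i) * real n powr \<kappa> * ln (real n)))"
        proof (rule prod_mono, rule conjI)
          fix i assume i: "i \<in> {2..r}"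
          have "real (card (\<C> i)) \<le> exp (real (T i) * real n powr (real k - 1 / ?m i) * ln (real n))"
            using \<C>[OF i] unfolding container_family_def by blast
          also have "\<dots> \<le> exp (real (T i) * real n powr \<kappa> * ln (real n))"
          proof -
            have "real n powr (real k - 1 / ?m i) \<le> real n powr \<kappa>"
              using \<kappa>_ge[OF i] n0 by (intro powr_mono) auto
            then have "real (T i) * real n powr (real k - 1 / ?m i) * ln (real n)
                \<le> real (T i) * real n powr \<kappa> * ln (real n)"
              using lnn by (intro mult_right_mono mult_left_mono) auto
            then show ?thesis by simp
          qed
          finally show "real (card (\<C> i)) \<le> exp (real (T i) * real n powr \<kappa> * ln (real n))" .
        qed simp
        also have "\<dots> = exp (t * real n powr \<kappa> * ln (real n))"
          unfolding t_def by (simp add: exp_sum sum_distrib_right)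
        finally show "(\<Prod>i\<in>{2..r}. real (card (\<C> i))) \<le> exp (t * real n powr \<kappa> * ln (real n))" .
      qed simp
      also have "\<dots> = exp (t * (real n powr \<kappa> * ln (real n)) - c * C * (real n powr \<kappa> * ln (real n)))"
        unfolding L_def by (simp add: mult_ac flip: exp_add)
      also have "\<dots> \<le> exp (- ln (real n))"
      proof -
        have "1 * ln (real n) \<le> real n powr \<kappa> * ln (real n)"
          using \<kappa>0 n0 lnn by (intro mult_right_mono) (auto simp: ge_one_powr_ge_zero)
        moreover have "(t + 1) * (real n powr \<kappa> * ln (real n)) \<le> c * C * (real n powr \<kappa> * ln (real n))"
          using cC lnn by (intro mult_right_mono) auto
        ultimately show ?thesis by (simp add: algebra_simps)
      qed
      also have "\<dots> = 1 / real n" using n0 by (simp add: exp_minus divide_inverse)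
      finally have fail: "P {X. \<not> arrows (Hypergraph {1..n} {e \<in> k_sets k n. X e}) r F} \<le> 1 / real n" .
      have "measure_pmf.prob (binomial_hypergraph k n (p n)) {G. arrows G r F}
          = P {X. arrows (Hypergraph {1..n} {e \<in> k_sets k n. X e}) r F}"
        unfolding binomial_hypergraph_def P_def by (simp add: vimage_def)
      also have "\<dots> = 1 - P {X. \<not> arrows (Hypergraph {1..n} {e \<in> k_sets k n. X e}) r F}"
      proof -
        have "{X. \<not> arrows (Hypergraph {1..n} {e \<in> k_sets k n. X e}) r F}
          = UNIV - {X. arrows (Hypergraph {1..n} {e \<in> k_sets k n. X e}) r F}" by blast
        then show ?thesis
          unfolding P_def
          using measure_pmf.prob_compl[of "{X. arrows (Hypergraph {1..n} {e \<in> k_sets k n. X e}) r F}"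
              "Pi_pmf (k_sets k n) False (\<lambda>_. bernoulli_pmf (p n))"] by simp
      qed
      finally show ?case using fail by simp
    qed
    have inv: "(\<lambda>n. 1 - 1 / real n) \<longlonglongrightarrow> 1"
      using tendsto_diff[OF tendsto_const[of 1] lim_1_over_n] by simp
    show ?thesis
      by (rule tendsto_sandwich[OF low _ inv tendsto_const]) (simp add: measure_pmf.prob_le_1)
  qed
  have "0 < C" using C1 by simp
  then show ?thesis using lim by (intro exI[of _ C] conjI allI impI)
qed

end
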